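(* For every $a>1/2$ and every integer $k$ with $|k|\ge 2$, $\mu_n^{\mathrm{odd}}(k)>0$ for all $n\ge 0$. Equivalently, the odd radial sector of mode $k$ contains neither negative nor zero eigenvalues; in particular, every Robin Jacobi field of mode $|k|\ge 2$ must be radially even.
   Context: For $a>1/2$ put $A(s)=\sqrt{a\cosh(2s)+\tfrac12}$, $B(s)=\sqrt{a\cosh(2s)-\tfrac12}$, $K=K(a)=\sqrt{a^2-\tfrac14}$, and $\varphi(s)=\int_0^s\frac{K}{A(t)^2B(t)}\,dt$. Let $s_0=s_0(a)>0$ be the unique positive solution of $\tanh\varphi(s_0)=\frac{B(s_0)K}{a\sinh(2s_0)}$, and let $r(a)>0$ be defined by $\cosh r(a)=A(s_0)\cosh\varphi(s_0)$. The critical spherical catenoid $\Sigma_a$ is the rotational free boundary minimal annulus in the geodesic ball of radius $r(a)$ of $\mathbb{H}^3$ with coordinates $(s,\theta)\in[-s_0,s_0]\times S^1$, induced metric $g=ds^2+B(s)^2d\theta^2$ and $|\mathrm{II}|^2=2K^2/B^4$. For $k\in\mathbb{Z}$ set $W_k(s)=|\mathrm{II}|^2(s)-2-k^2/B(s)^2$ and, for $u\in H^1((-s_0,s_0))$, $$\mathcal{S}_k^{\mathrm{rad}}(u,u)=\int_{-s_0}^{s_0}\bigl[B(u')^2-BW_ku^2\bigr]ds-\coth r(a)\,B(s_0)\bigl[u(s_0)^2+u(-s_0)^2\bigr].$$ $\mu_n^{\mathrm{odd}}(k)$, $n\ge0$, is the $(n+1)$-th eigenvalue (increasing order, with multiplicity,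 given by the Courant–Fischer min-max principle) of $\mathcal{S}_k^{\mathrm{rad}}$ relative to the weighted norm $\int_{-s_0}^{s_0}Bu^2\,ds$, restricted to functions odd under $s\mapsto -s$. A Robin Jacobi field is a function $u$ on $\Sigma_a$ with $L_\Sigma u:=\Delta_gu+(|\mathrm{II}|^2-2)u=0$ and $\partial_\eta u=\coth r(a)\,u$ on $\partial\Sigma_a$ ($\eta$ the outward unit conormal). It is of mode $|k|$, $|k|\ge1$, if it is of the form $\alpha(s)\cos k\theta+\beta(s)\sin k\theta$, and radially even (odd) if its radial profiles $\alpha,\beta$ are even (odd) in $s$. *)

theory Defs
  imports "HOL-Analysis.Analysis" "HOL-Library.Function_Algebras"
begin

definition cat_A :: "real \<Rightarrow> real \<Rightarrow> real"
  where "cat_A a s = sqrt (a * cosh (2 * s) + 1 / 2)"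

definition cat_B :: "real \<Rightarrow> real \<Rightarrow> real"
  where "cat_B a s = sqrt (a * cosh (2 * s) - 1 / 2)"

definition cat_K :: "real \<Rightarrow> real"
  where "cat_K a = sqrt (a\<^sup>2 - 1 / 4)"

definition cat_phi :: "real \<Rightarrow> real \<Rightarrow> real"
  where "cat_phi a s = (LBINT t=0..s. cat_K a / ((cat_A a t)\<^sup>2 * cat_B a t))"

definition cat_s0 :: "real \<Rightarrow> real"
  where "cat_s0 a =
    (THE s. s > 0 \<and> tanh (cat_phi a s) = cat_B a s * cat_K a / (a * sinh (2 * s)))"

definition cat_r :: "real \<Rightarrow> real"
  where "cat_r a =
    (THE r. r > 0 \<and> cosh r = cat_A a (cat_s0 a) * cosh (cat_phi a (cat_s0 a)))"

definition coth :: "real \<Rightarrow> real"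
  where "coth x = cosh x / sinh x"

definition II_sq :: "real \<Rightarrow> real \<Rightarrow> real"
  where "II_sq a s = 2 * (cat_K a)\<^sup>2 / (cat_B a s) ^ 4"

definition W :: "real \<Rightarrow> int \<Rightarrow> real \<Rightarrow> real"
  where "W a k s = II_sq a s - 2 - (real_of_int k)\<^sup>2 / (cat_B a s)\<^sup>2"


section \<open>The Sobolev space on a symmetric interval\<close>

definition L2_on :: "real set \<Rightarrow> (real \<Rightarrow> real) \<Rightarrow> bool"
  where "L2_on I f \<longleftrightarrow>
    set_borel_measurable lborel I f \<and> set_integrable lborel I (\<lambda>x. (f x)\<^sup>2)"

definition test_function :: "real set \<Rightarrow> (real \<Rightarrow> real) \<Rightarrow> bool"
  where "test_function I \<psi> \<longleftrightarrow>
    \<psi> C1_differentiable_on UNIV \<and> (\<exists>C. compact C \<and> C \<subseteq> I \<and> (\<forall>x. x \<notin> C \<longrightarrow> \<psi> x = 0))"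

definition has_weak_deriv :: "real \<Rightarrow> (real \<Rightarrow> real) \<Rightarrow> (real \<Rightarrow> real) \<Rightarrow> bool"
  where "has_weak_deriv c u g \<longleftrightarrow>
    L2_on {-c<..<c} g \<and>
    (\<forall>\<psi>. test_function {-c<..<c} \<psi> \<longrightarrow>
      (LBINT x:{-c<..<c}. u x * deriv \<psi> x) = - (LBINT x:{-c<..<c}. g x * \<psi> x))"

text \<open>
  Every class in H1 of an interval has a unique representative that is continuous on the closed
  interval, and traces at the end points are the values of this representative. We use these
  representatives, set to 0 outside the closed interval, so that distinct functions in the
  following set are distinct elements of H1.
\<close>

definition H1 :: "real \<Rightarrow> (real \<Rightarrow> real) set"
  where "H1 c = {u. continuous_on {-c..c} u \<and> (\<forall>x. x \<notin> {-c..c} \<longrightarrow> u x = 0) \<and>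
    L2_on {-c<..<c} u \<and> (\<exists>g. has_weak_deriv c u g)}"

definition H1_odd :: "real \<Rightarrow> (real \<Rightarrow> real) set"
  where "H1_odd c = {u \<in> H1 c. \<forall>x. u (- x) = - u x}"

text \<open>The weak derivative is determined up to null sets only; it is used only under integrals.\<close>

definition weak_deriv :: "real \<Rightarrow> (real \<Rightarrow> real) \<Rightarrow> real \<Rightarrow> real"
  where "weak_deriv c u = (SOME g. has_weak_deriv c u g)"


section \<open>The radial form and its odd spectrum\<close>

definition S_rad :: "real \<Rightarrow> int \<Rightarrow> (real \<Rightarrow> real) \<Rightarrow> (real \<Rightarrow> real) \<Rightarrow> real"
  where "S_rad a k u v = (let s0 = cat_s0 a in
    (LBINT s:{-s0<..<s0}. cat_B a s * weak_deriv s0 u s * weak_deriv s0 v s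
                          - cat_B a s * W a k s * u s * v s)
    - coth (cat_r a) * cat_B a s0 * (u s0 * v s0 + u (- s0) * v (- s0)))"

definition B_inner :: "real \<Rightarrow> (real \<Rightarrow> real) \<Rightarrow> (real \<Rightarrow> real) \<Rightarrow> real"
  where "B_inner a u v = (LBINT s:{-cat_s0 a<..<cat_s0 a}. cat_B a s * u s * v s)"

definition fscale :: "real \<Rightarrow> (real \<Rightarrow> real) \<Rightarrow> real \<Rightarrow> real"
  where "fscale c f = (\<lambda>x. c * f x)"

text \<open>
  Courant-Fischer value over all (n+1)-dimensional spaces of odd functions. It lives in the
  extended reals so that no infimum or supremum takes an arbitrary value.
\<close>

definition mu_odd :: "real \<Rightarrow> int \<Rightarrow> nat \<Rightarrow> ereal"
  where "mu_odd a k n =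
    (INF V \<in> {V. module.subspace fscale V \<and> V \<subseteq> H1_odd (cat_s0 a) \<and>
                 vector_space.dim fscale V = Suc n}.
      SUP u \<in> V - {0}. ereal (S_rad a k u u / B_inner a u u))"

definition odd_eigenvalue :: "real \<Rightarrow> int \<Rightarrow> real \<Rightarrow> bool"
  where "odd_eigenvalue a k l \<longleftrightarrow>
    (\<exists>u \<in> H1_odd (cat_s0 a). u \<noteq> 0 \<and>
      (\<forall>v \<in> H1_odd (cat_s0 a). S_rad a k u v = l * B_inner a u v))"


section \<open>Robin Jacobi fields\<close>

text \<open>
  Functions on the annulus are functions of s in [-c, c] and of a real angle, with period 2 pi
  in the angle. Derivatives in s are one-sided at the boundary.
\<close>

definition pd_s :: "real \<Rightarrow> (real \<Rightarrow> real \<Rightarrow> real) \<Rightarrow> real \<Rightarrow> real \<Rightarrow> real"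
  where "pd_s c u s \<theta> = vector_derivative (\<lambda>t. u t \<theta>) (at s within {-c..c})"

definition pd_th :: "(real \<Rightarrow> real \<Rightarrow> real) \<Rightarrow> real \<Rightarrow> real \<Rightarrow> real"
  where "pd_th u s \<theta> = deriv (u s) \<theta>"

fun Ck_annulus :: "nat \<Rightarrow> real \<Rightarrow> (real \<Rightarrow> real \<Rightarrow> real) \<Rightarrow> bool"
  where
    "Ck_annulus 0 c u \<longleftrightarrow>
      continuous_on ({-c..c} \<times> UNIV) (\<lambda>(s, \<theta>). u s \<theta>) \<and>
      (\<forall>s \<in> {-c..c}. \<forall>\<theta>. u s (\<theta> + 2 * pi) = u s \<theta>)"
  | "Ck_annulus (Suc m) c u \<longleftrightarrow>
      Ck_annulus 0 c u \<and>
      (\<forall>s \<in> {-c..c}. \<forall>\<theta>.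
        (\<lambda>t. u t \<theta>) differentiable (at s within {-c..c}) \<and> u s differentiable (at \<theta>)) \<and>
      Ck_annulus m c (pd_s c u) \<and> Ck_annulus m c (pd_th u)"

text \<open>The Laplace-Beltrami operator of the metric E ds^2 + 2 F ds d\<theta> + G d\<theta>^2.\<close>

definition laplace_beltrami ::
    "real \<Rightarrow> (real \<Rightarrow> real \<Rightarrow> real) \<Rightarrow> (real \<Rightarrow> real \<Rightarrow> real) \<Rightarrow> (real \<Rightarrow> real \<Rightarrow> real)
      \<Rightarrow> (real \<Rightarrow> real \<Rightarrow> real) \<Rightarrow> real \<Rightarrow> real \<Rightarrow> real"
  where "laplace_beltrami c E F G u s \<theta> =
    (let D = (\<lambda>s \<theta>. sqrt (E s \<theta> * G s \<theta> - (F s \<theta>)\<^sup>2)) in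
      (pd_s c (\<lambda>s \<theta>. (G s \<theta> * pd_s c u s \<theta> - F s \<theta> * pd_th u s \<theta>) / D s \<theta>) s \<theta>
       + pd_th (\<lambda>s \<theta>. (E s \<theta> * pd_th u s \<theta> - F s \<theta> * pd_s c u s \<theta>) / D s \<theta>) s \<theta>)
      / D s \<theta>)"

definition jacobi_op :: "real \<Rightarrow> (real \<Rightarrow> real \<Rightarrow> real) \<Rightarrow> real \<Rightarrow> real \<Rightarrow> real"
  where "jacobi_op a u s \<theta> =
    laplace_beltrami (cat_s0 a) (\<lambda>s \<theta>. 1) (\<lambda>s \<theta>. 0) (\<lambda>s \<theta>. (cat_B a s)\<^sup>2) u s \<theta>
    + (II_sq a s - 2) * u s \<theta>"

text \<open>The outward unit conormal is d/ds at s = s0 and -d/ds at s = -s0.\<close>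

definition robin_jacobi_field :: "real \<Rightarrow> (real \<Rightarrow> real \<Rightarrow> real) \<Rightarrow> bool"
  where "robin_jacobi_field a u \<longleftrightarrow> (let s0 = cat_s0 a in
    Ck_annulus 2 s0 u \<and>
    (\<forall>s \<in> {-s0..s0}. \<forall>\<theta>. jacobi_op a u s \<theta> = 0) \<and>
    (\<forall>\<theta>. pd_s s0 u s0 \<theta> = coth (cat_r a) * u s0 \<theta>) \<and>
    (\<forall>\<theta>. - pd_s s0 u (- s0) \<theta> = coth (cat_r a) * u (- s0) \<theta>))"

text \<open>For nonzero k the profiles are determined by u on [-s0, s0].\<close>

definition radial_profiles ::
    "real \<Rightarrow> int \<Rightarrow> (real \<Rightarrow> real \<Rightarrow> real) \<Rightarrow> (real \<Rightarrow> real) \<Rightarrow> (real \<Rightarrow> real) \<Rightarrow> bool"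
  where "radial_profiles a k u \<alpha> \<beta> \<longleftrightarrow>
    (\<forall>s \<in> {-cat_s0 a..cat_s0 a}. \<forall>\<theta>.
      u s \<theta> = \<alpha> s * cos (real_of_int k * \<theta>) + \<beta> s * sin (real_of_int k * \<theta>))"

definition of_mode :: "real \<Rightarrow> int \<Rightarrow> (real \<Rightarrow> real \<Rightarrow> real) \<Rightarrow> bool"
  where "of_mode a k u \<longleftrightarrow> (\<exists>\<alpha> \<beta>. radial_profiles a k u \<alpha> \<beta>)"

definition radially_even :: "real \<Rightarrow> int \<Rightarrow> (real \<Rightarrow> real \<Rightarrow> real) \<Rightarrow> bool"
  where "radially_even a k u \<longleftrightarrow>
    (\<forall>\<alpha> \<beta>. radial_profiles a k u \<alpha> \<beta> \<longrightarrow>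
      (\<forall>s \<in> {-cat_s0 a..cat_s0 a}. \<alpha> (- s) = \<alpha> s \<and> \<beta> (- s) = \<beta> s))"

end

theory Submission
  imports Defs
begin

text \<open>
  The free boundary of the critical catenoid \<open>\<Sigma>\<^sub>a\<close> lies on a geodesic sphere. Rotations about the
  centre of that sphere preserve the ball, so a rotation about an axis through the centre perpendicular
  to the axis of symmetry moves \<open>\<Sigma>\<^sub>a\<close> through free boundary minimal annuli. The normal component
  of this rotation is therefore an exact Robin Jacobi field; it has mode 1, and its profile \<open>w\<close> is odd and positive on \<open>(0, s\<^sub>0]\<close>. Explicitly, with
  \<open>D = a sinh 2s\<close>, one has \<open>w = K/(AB) sinh \<phi> + D/A cosh \<phi>\<close>.

  A positive solution controls the quadratic form (Jacobi, Picone): for odd \<open>u\<close>, completing the square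
  in \<open>B (u' - (w'/w) u)\<^sup>2 \<ge> 0\<close> over \<open>(0, s\<^sub>0)\<close> shows that the mode 1 form, boundary term included, is
  nonnegative. Passing from mode 1 to mode \<open>k\<close> adds \<open>(k\<^sup>2 - 1) \<integral> u\<^sup>2/B\<close>, and \<open>B\<close> is largest at \<open>s\<^sub>0\<close>.
  This gives the explicit gap
  \<open>S_rad u u \<ge> (k\<^sup>2 - 1)/B(s\<^sub>0)\<^sup>2 B_inner u u\<close> on odd functions (\<open>odd_coercivity\<close>), which is strictly
  positive as soon as \<open>|k| \<ge> 2\<close>. It bounds every min-max value and every eigenvalue from below, and it
  kills the odd part of a Robin Jacobi field, whose form vanishes.

  The logarithmic derivative of \<open>w\<close> is singular at 0. This is avoided by adding \<open>d > 0\<close> times the mode 1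
  Jacobi field of a translation perpendicular to the axis of symmetry, which has an even positive
  profile: the sum is positive on all of \<open>[0, s\<^sub>0]\<close> (\<open>jacobi_profile\<close>), violates the Robin condition
  only by an error that tends to 0 with \<open>d\<close>, and so yields the inequality in the limit (\<open>half_coercivity_mode_1\<close>).

  The analysis is done for functions that are primitives of integrable functions: elements of H1 are of
  this kind (\<open>weak_deriv_primitive_on\<close>), and they obey the product rule (\<open>primitive_on_mult\<close>), which is
  all that the square completion uses.
\<close>

section \<open>Absolutely continuous functions as primitives\<close>

text \<open>
  Absolute continuity on an interval, with a chosen density. The density matters up to null sets only,
  so weak derivatives fit in directly.
\<close>

definition primitive_on :: "real \<Rightarrow> real \<Rightarrow> (real \<Rightarrow> real) \<Rightarrow> (real \<Rightarrow> real) \<Rightarrow> bool"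
  where "primitive_on l r u g \<longleftrightarrow>
    set_integrable lborel {l..r} g \<and> (\<forall>x\<in>{l..r}. u x = u l + (LBINT t:{l..x}. g t))"

lemma primitive_onD:
  assumes "primitive_on l r u g" "l \<le> x" "x \<le> r"
  shows "u x = u l + (LBINT t:{l..x}. g t)"
proof -
  have "\<forall>x\<in>{l..r}. u x = u l + (LBINT t:{l..x}. g t)"
    using assms(1) unfolding primitive_on_def by (rule conjunct2)
  then show ?thesis
    by (rule bspec) (use assms in simp)
qed

lemma primitive_on_continuous:
  assumes "primitive_on l r u g"
  shows "continuous_on {l..r} u"
proof -
  have g: "set_integrable lborel {l..r} g"
    using assms by (simp only: primitive_on_def)
  have eq: "u l + integral {l..x} g = u x" if "x \<in> {l..r}" for x
  proof -
    have "set_integrable lborel {l..x} g"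
      using set_integrable_subset[OF g, of "{l..x}"] that by auto
    then show ?thesis
      using primitive_onD[OF assms, of x] that set_borel_integral_eq_integral(2)[of "{l..x}" g] by simp
  qed
  have "continuous_on {l..r} (\<lambda>x. u l + integral {l..x} g)"
    by (intro continuous_intros indefinite_integral_continuous_1 set_borel_integral_eq_integral g)
  then show ?thesis
    by (rule continuous_on_cong[THEN iffD1, OF refl eq, rotated])
qed

lemma primitive_on_subset:
  assumes "primitive_on l r u g" "l \<le> x" "x \<le> r"
  shows "primitive_on l x u g"
proof -
  have "set_integrable lborel {l..x} g"
    using assms set_integrable_subset[of lborel "{l..r}" g "{l..x}"] by (simp add: primitive_on_def)
  moreover have "u y = u l + (LBINT t:{l..y}. g t)" if "y \<in> {l..x}" for y
    using that assms(2,3) by (intro primitive_onD[OF assms(1)]) auto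
  ultimately show ?thesis
    unfolding primitive_on_def by (intro conjI ballI)
qed

lemma primitive_on_integral:
  assumes "primitive_on l r u g" "l \<le> r"
  shows "(LBINT t:{l..r}. g t) = u r - u l"
  using primitive_onD[OF assms order.refl] by linarith

lemma set_integrable_open_iff_closed:
  fixes f :: "real \<Rightarrow> real"
  shows "set_integrable lborel {l<..<r} f \<longleftrightarrow> set_integrable lborel {l..r} f"
  by (rule set_integrable_discrete_difference[where X = "{l, r}"]) (auto simp: emeasure_lborel_countable)

lemma set_integral_open_eq_closed:
  fixes f :: "real \<Rightarrow> real"
  shows "(LBINT x:{l<..<r}. f x) = (LBINT x:{l..r}. f x)"
  by (rule set_integral_discrete_difference[where X = "{l, r}"]) (auto simp: emeasure_lborel_countable)

lemma primitive_on_lborel_integral: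
  assumes "set_integrable lborel {l..r} g"
  shows "primitive_on l r (\<lambda>x. LBINT t:{l..x}. g t) g"
proof -
  have "(LBINT t:{l}. g t) = 0"
    using set_integral_open_eq_closed[of l l g] by (simp add: set_lebesgue_integral_def)
  then show ?thesis
    using assms by (simp add: primitive_on_def)
qed

lemma primitive_on_C1:
  assumes d: "\<And>x. x \<in> {l..r} \<Longrightarrow> (u has_vector_derivative u' x) (at x within {l..r})"
    and c: "continuous_on {l..r} u'"
  shows "primitive_on l r u u'"
proof -
  have "u x = u l + (LBINT t:{l..x}. u' t)" if x: "x \<in> {l..r}" for x
  proof -
    have "(LBINT t. indicator {l..x} t *\<^sub>R u' t) = u x - u l"
    proof (rule integral_FTC_atLeastAtMost)
      show "continuous_on {l..x} u'" using continuous_on_subset[OF c, of "{l..x}"] x by auto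
      show "(u has_vector_derivative u' t) (at t within {l..x})" if "l \<le> t" "t \<le> x" for t
        using has_vector_derivative_within_subset[OF d[of t], of "{l..x}"] x that by auto
    qed (use x in auto)
    then show ?thesis unfolding set_lebesgue_integral_def by linarith
  qed
  then show ?thesis
    unfolding primitive_on_def by (intro conjI ballI borel_integrable_atLeastAtMost'[OF c])
qed

lemma primitive_on_linear:
  assumes u: "primitive_on l r u g" and v: "primitive_on l r v h"
  shows "primitive_on l r (\<lambda>x. a * u x + b * v x) (\<lambda>x. a * g x + b * h x)"
proof -
  have g: "set_integrable lborel {l..r} g" and h: "set_integrable lborel {l..r} h"
    using u v by (simp_all only: primitive_on_def)
  have "a * u x + b * v x = a * u l + b * v l + (LBINT t:{l..x}. a * g t + b * h t)"
    if "x \<in> {l..r}" for x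
  proof -
    have x: "l \<le> x" "x \<le> r" using that by auto
    have "set_integrable lborel {l..x} (\<lambda>t. a * g t)" "set_integrable lborel {l..x} (\<lambda>t. b * h t)"
      using set_integrable_subset[OF g, of "{l..x}"] set_integrable_subset[OF h, of "{l..x}"] x by auto
    from set_integral_add(2)[OF this]
    have "(LBINT t:{l..x}. a * g t + b * h t) = a * (LBINT t:{l..x}. g t) + b * (LBINT t:{l..x}. h t)"
      by simp
    moreover have "(LBINT t:{l..x}. g t) = u x - u l" "(LBINT t:{l..x}. h t) = v x - v l"
      using primitive_onD[OF u x] primitive_onD[OF v x] by simp_all
    ultimately show ?thesis by (simp add: algebra_simps)
  qed
  moreover have "set_integrable lborel {l..r} (\<lambda>x. a * g x + b * h x)"
    by (intro set_integral_add(1) set_integrable_mult_right g h)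
  ultimately show ?thesis
    unfolding primitive_on_def by (intro conjI ballI)
qed

lemma set_integrable_mult_continuous:
  fixes f h :: "real \<Rightarrow> real"
  assumes f: "set_integrable lborel {l..r} f" and h: "continuous_on {l..r} h"
  shows "set_integrable lborel {l..r} (\<lambda>x. h x * f x)"
proof -
  obtain M where M: "\<And>x. x \<in> {l..r} \<Longrightarrow> \<bar>h x\<bar> \<le> M"
    using compact_imp_bounded[OF compact_continuous_image[OF h compact_Icc]]
    unfolding bounded_iff by (metis imageI real_norm_def)
  have h0: "(\<lambda>x. indicator {l..r} x *\<^sub>R h x) \<in> borel_measurable lborel"
    using borel_measurable_continuous_on_indicator[OF _ h] by simp
  have f0: "(\<lambda>x. indicator {l..r} x *\<^sub>R f x) \<in> borel_measurable lborel"
    using f by (auto simp: set_integrable_def dest: borel_measurable_integrable)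
  have "(\<lambda>x. indicator {l..r} x *\<^sub>R (h x * f x)) =
      (\<lambda>x. (indicator {l..r} x *\<^sub>R h x) * (indicator {l..r} x *\<^sub>R f x))"
    by (auto split: split_indicator)
  then have m: "set_borel_measurable lborel {l..r} (\<lambda>x. h x * f x)"
    using borel_measurable_times[OF h0 f0] by (simp add: set_borel_measurable_def)
  show ?thesis
  proof (rule set_integrable_bound[OF _ m])
    show "set_integrable lborel {l..r} (\<lambda>x. M * f x)"
      using f by simp
    show "AE x in lborel. x \<in> {l..r} \<longrightarrow> norm (h x * f x) \<le> norm (M * f x)"
      using M by (auto simp: abs_mult intro!: AE_I2 mult_right_mono order_trans[OF M abs_ge_self])
  qed
qed

text \<open>
  Fubini on the square \<open>[l, r]\<^sup>2\<close>, cut along its diagonal. This is integration by parts for two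
  primitives that vanish at \<open>l\<close>.
\<close>

lemma integral_product_triangles:
  fixes f g :: "real \<Rightarrow> real"
  assumes f: "set_integrable lborel {l..r} f" and g: "set_integrable lborel {l..r} g"
  shows "(LBINT x:{l..r}. f x) * (LBINT y:{l..r}. g y) =
    (LBINT y:{l..r}. (LBINT x:{l..y}. f x) * g y) + (LBINT x:{l..r}. f x * (LBINT y:{l..x}. g y))"
proof -
  define f0 where "f0 x = indicator {l..r} x * f x" for x
  define g0 where "g0 x = indicator {l..r} x * g x" for x
  have f0 [simp, intro]: "integrable lborel f0" and g0 [simp, intro]: "integrable lborel g0"
    using f g by (simp_all add: set_integrable_def f0_def[abs_def] g0_def[abs_def])
  have [measurable]: "f0 \<in> borel_measurable borel" "g0 \<in> borel_measurable borel"
    using borel_measurable_integrable[OF f0] borel_measurable_integrable[OF g0] by auto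
  let ?P = "lborel \<Otimes>\<^sub>M (lborel :: real measure)"
  have H: "integrable ?P (\<lambda>(x, y). f0 x * g0 y)"
  proof (rule lborel_pair.Fubini_integrable)
    show "integrable lborel (\<lambda>x. LBINT y. norm (case (x, y) of (x, y) \<Rightarrow> f0 x * g0 y))"
      by (simp add: abs_mult)
  qed auto
  have H1: "integrable ?P (\<lambda>(x, y). if x \<le> y then f0 x * g0 y else 0)"
    by (rule Bochner_Integration.integrable_bound[OF H]) (auto simp: split_beta)
  have H2: "integrable ?P (\<lambda>(x, y). if y < x then f0 x * g0 y else 0)"
    by (rule Bochner_Integration.integrable_bound[OF H]) (auto simp: split_beta)
  have "(LBINT x:{l..r}. f x) * (LBINT y:{l..r}. g y) = (LBINT x. f0 x) * (LBINT y. g0 y)"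
    by (simp add: set_lebesgue_integral_def f0_def g0_def)
  also have "\<dots> = (LBINT x. (LBINT y. f0 x * g0 y))"
    by simp
  also have "\<dots> = integral\<^sup>L ?P (\<lambda>(x, y). f0 x * g0 y)"
    using lborel_pair.integral_fst'[OF H] by simp
  also have "\<dots> = integral\<^sup>L ?P (\<lambda>z. (case z of (x, y) \<Rightarrow> if x \<le> y then f0 x * g0 y else 0)
        + (case z of (x, y) \<Rightarrow> if y < x then f0 x * g0 y else 0))"
    by (rule Bochner_Integration.integral_cong) auto
  also have "\<dots> = integral\<^sup>L ?P (\<lambda>(x, y). if x \<le> y then f0 x * g0 y else 0)
        + integral\<^sup>L ?P (\<lambda>(x, y). if y < x then f0 x * g0 y else 0)"
    by (rule Bochner_Integration.integral_add[OF H1 H2])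
  also have "integral\<^sup>L ?P (\<lambda>(x, y). if x \<le> y then f0 x * g0 y else 0)
      = (LBINT y. (LBINT x. if x \<le> y then f0 x * g0 y else 0))"
    using lborel_pair.integral_snd[OF H1] by simp
  also have "\<dots> = (LBINT y. indicator {l..r} y *\<^sub>R ((LBINT x:{l..y}. f x) * g y))"
  proof (rule Bochner_Integration.integral_cong[OF refl])
    fix y :: real
    have "(LBINT x. if x \<le> y then f0 x * g0 y else 0) = (LBINT x. (indicator {l..min r y} x * f x) * g0 y)"
      by (rule Bochner_Integration.integral_cong) (auto simp: f0_def split: split_indicator)
    also have "\<dots> = (LBINT x. indicator {l..min r y} x * f x) * g0 y"
      by simp
    also have "\<dots> = indicator {l..r} y *\<^sub>R ((LBINT x:{l..y}. f x) * g y)"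
    proof (cases "y \<in> {l..r}")
      case True
      then have "min r y = y" by simp
      with True show ?thesis by (simp add: g0_def set_lebesgue_integral_def)
    qed (simp add: g0_def)
    finally show "(LBINT x. if x \<le> y then f0 x * g0 y else 0) = \<dots>" .
  qed
  also have "integral\<^sup>L ?P (\<lambda>(x, y). if y < x then f0 x * g0 y else 0)
      = (LBINT x. (LBINT y. if y < x then f0 x * g0 y else 0))"
    using lborel_pair.integral_fst'[OF H2] by simp
  also have "\<dots> = (LBINT x. indicator {l..r} x *\<^sub>R (f x * (LBINT y:{l..x}. g y)))"
  proof (rule Bochner_Integration.integral_cong[OF refl])
    fix x :: real
    have "(LBINT y. if y < x then f0 x * g0 y else 0) = (LBINT y. f0 x * (indicator {l..min r x} y * g y))"
    proof (cases "x \<in> {l..r}")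
      case True
      show ?thesis
      proof (rule integral_cong_AE)
        show "AE y in lborel. (if y < x then f0 x * g0 y else 0) = f0 x * (indicator {l..min r x} y * g y)"
          using AE_lborel_singleton[of x]
          by eventually_elim (use True in \<open>auto simp: g0_def split: split_indicator\<close>)
        have eq: "(\<lambda>y. indicator {l..min r x} y * g y) = (\<lambda>y. indicator {..x} y * g0 y)"
          by (auto simp: g0_def fun_eq_iff split: split_indicator)
        show "(\<lambda>y. f0 x * (indicator {l..min r x} y * g y)) \<in> borel_measurable lborel"
          by (rule borel_measurable_times[OF borel_measurable_const]) (subst eq, measurable)
      qed measurable
    next
      case False
      then show ?thesis
        by (simp add: f0_def cong: if_cong)
    qed
    also have "\<dots> = f0 x * (LBINT y. (indicator {l..min r x} y * g y))"
      by simp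
    also have "\<dots> = indicator {l..r} x *\<^sub>R (f x * (LBINT y:{l..x}. g y))"
    proof (cases "x \<in> {l..r}")
      case True
      then have "min r x = x" by simp
      with True show ?thesis by (simp add: f0_def set_lebesgue_integral_def)
    qed (simp add: f0_def)
    finally show "(LBINT y. if y < x then f0 x * g0 y else 0) = \<dots>" .
  qed
  finally show ?thesis
    by (simp add: set_lebesgue_integral_def)
qed

lemma primitive_on_mult:
  assumes F: "primitive_on l r F f" and G: "primitive_on l r G g"
  shows "primitive_on l r (\<lambda>x. F x * G x) (\<lambda>x. F x * g x + G x * f x)"
proof -
  have cF: "continuous_on {l..r} F" and cG: "continuous_on {l..r} G"
    using F G by (simp_all add: primitive_on_continuous)
  have f: "set_integrable lborel {l..r} f" and g: "set_integrable lborel {l..r} g"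
    using F G by (simp_all only: primitive_on_def)
  have int: "set_integrable lborel {l..r} (\<lambda>x. F x * g x)" "set_integrable lborel {l..r} (\<lambda>x. G x * f x)"
    by (intro set_integrable_mult_continuous f g cF cG)+
  have "F x * G x = F l * G l + (LBINT t:{l..x}. F t * g t + G t * f t)" if x: "x \<in> {l..r}" for x
  proof -
    have sub: "set_integrable lborel {l..x} h" if "set_integrable lborel {l..r} h" for h :: "real \<Rightarrow> real"
      using set_integrable_subset[OF that, of "{l..x}"] x by auto
    have F': "F t = F l + (LBINT t:{l..t}. f t)" and G': "G t = G l + (LBINT t:{l..t}. g t)"
      if "t \<in> {l..x}" for t
      using that x by (auto intro!: primitive_onD[OF F] primitive_onD[OF G])
    have i1: "set_integrable lborel {l..x} (\<lambda>t. F t * g t)" "set_integrable lborel {l..x} (\<lambda>t. G t * f t)"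
      "set_integrable lborel {l..x} f" "set_integrable lborel {l..x} g"
      using int f g by (auto intro: sub)
    have a: "(LBINT t:{l..x}. (LBINT s:{l..t}. f s) * g t) = (LBINT t:{l..x}. F t * g t - F l * g t)"
    proof (rule set_lebesgue_integral_cong)
      show "\<forall>t. t \<in> {l..x} \<longrightarrow> (LBINT s:{l..t}. f s) * g t = F t * g t - F l * g t"
      proof (intro allI impI)
        fix t assume "t \<in> {l..x}"
        from F'[OF this] have "(LBINT s:{l..t}. f s) = F t - F l"
          by linarith
        then show "(LBINT s:{l..t}. f s) * g t = F t * g t - F l * g t"
          by (simp only: left_diff_distrib)
      qed
    qed simp
    have b: "(LBINT t:{l..x}. f t * (LBINT s:{l..t}. g s)) = (LBINT t:{l..x}. G t * f t - G l * f t)"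
    proof (rule set_lebesgue_integral_cong)
      show "\<forall>t. t \<in> {l..x} \<longrightarrow> f t * (LBINT s:{l..t}. g s) = G t * f t - G l * f t"
      proof (intro allI impI)
        fix t assume "t \<in> {l..x}"
        from G'[OF this] have "(LBINT s:{l..t}. g s) = G t - G l"
          by linarith
        then show "f t * (LBINT s:{l..t}. g s) = G t * f t - G l * f t"
          by (simp only: right_diff_distrib mult.commute)
      qed
    qed simp
    have Fx: "(LBINT t:{l..x}. f t) = F x - F l" and Gx: "(LBINT t:{l..x}. g t) = G x - G l"
      using primitive_on_integral[OF primitive_on_subset] F G x by auto
    have i2: "set_integrable lborel {l..x} (\<lambda>t. F l * g t)" "set_integrable lborel {l..x} (\<lambda>t. G l * f t)"
      using i1 by simp_all
    have "(F x - F l) * (G x - G l) =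
        (LBINT t:{l..x}. F t * g t - F l * g t) + (LBINT t:{l..x}. G t * f t - G l * f t)"
      using integral_product_triangles[OF i1(3,4)] unfolding a b Fx Gx .
    also have "\<dots> = (LBINT t:{l..x}. F t * g t) - F l * (G x - G l)
        + ((LBINT t:{l..x}. G t * f t) - G l * (F x - F l))"
      unfolding set_integral_diff(2)[OF i1(1) i2(1)] set_integral_diff(2)[OF i1(2) i2(2)]
        set_integral_mult_right Fx Gx ..
    also have "\<dots> = (LBINT t:{l..x}. F t * g t + G t * f t) - F l * (G x - G l) - G l * (F x - F l)"
      unfolding set_integral_add(2)[OF i1(1,2)] by simp
    finally show ?thesis
      by (simp add: algebra_simps)
  qed
  then show ?thesis
    unfolding primitive_on_def by (intro conjI ballI set_integral_add(1)[OF int])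
qed

section \<open>Splitting and reflecting intervals\<close>

lemma LBINT_split:
  fixes f :: "real \<Rightarrow> real"
  assumes f: "set_integrable lborel {l..r} f" and m: "l \<le> m" "m \<le> r"
  shows "(LBINT x:{l..r}. f x) = (LBINT x:{l..m}. f x) + (LBINT x:{m..r}. f x)"
proof -
  have "set_integrable lborel {l..m} f" "set_integrable lborel {m..r} f"
    using set_integrable_subset[OF f, of "{l..m}"] set_integrable_subset[OF f, of "{m..r}"] m by auto
  then show ?thesis
    using Henstock_Kurzweil_Integration.integral_combine[OF m set_borel_integral_eq_integral(1)[OF f]]
      set_borel_integral_eq_integral(2)[OF f] set_borel_integral_eq_integral(2) by metis
qed

lemma LBINT_reflect:
  fixes f :: "real \<Rightarrow> real"
  shows "(LBINT x:{l..r}. f (- x)) = (LBINT x:{-r..-l}. f x)"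
proof -
  have "{x. - x \<in> {-r..-l}} = {l..r}" by auto
  then show ?thesis
    using set_integral_reflect[of "{-r..-l}" f] by simp
qed

lemma set_integrable_reflect:
  fixes f :: "real \<Rightarrow> real"
  assumes "set_integrable lborel {l..r} f"
  shows "set_integrable lborel {-r..-l} (\<lambda>x. f (- x))"
proof -
  have "integrable lborel (\<lambda>x. indicator {l..r} (0 + (-1) * x) *\<^sub>R f (0 + (-1) * x))"
    using assms unfolding set_integrable_def by (intro lborel_integrable_real_affine) auto
  moreover have "indicator {l..r} (- x) = (indicator {-r..-l} x :: real)" for x
    by (auto split: split_indicator)
  ultimately show ?thesis
    by (simp add: set_integrable_def)
qed

lemma LBINT_symmetric_interval:
  fixes f :: "real \<Rightarrow> real"
  assumes "set_integrable lborel {-c..c} f" "0 \<le> c"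
  shows "(LBINT x:{-c<..<c}. f x) = (LBINT x:{0..c}. f x) + (LBINT x:{0..c}. f (- x))"
  unfolding set_integral_open_eq_closed
  using LBINT_split[OF assms(1), of 0] LBINT_reflect[of 0 c f] assms(2) by simp

lemma primitive_on_restrict_left:
  assumes u: "primitive_on l r u g" and m: "l \<le> m" "m \<le> r"
  shows "primitive_on m r u g"
proof -
  have g: "set_integrable lborel {l..r} g" using u by (simp only: primitive_on_def)
  have "u x = u m + (LBINT t:{m..x}. g t)" if "x \<in> {m..r}" for x
  proof -
    have x: "m \<le> x" "x \<le> r" using that by auto
    have "set_integrable lborel {l..x} g"
      using set_integrable_subset[OF g, of "{l..x}"] x m by auto
    from LBINT_split[OF this m(1) x(1)] primitive_onD[OF u, of m] primitive_onD[OF u, of x] m x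
    show ?thesis by linarith
  qed
  moreover have "set_integrable lborel {m..r} g"
    using set_integrable_subset[OF g, of "{m..r}"] m by auto
  ultimately show ?thesis
    unfolding primitive_on_def by (intro conjI ballI)
qed

lemma primitive_on_reflect:
  assumes u: "primitive_on l r u g"
  shows "primitive_on (-r) (-l) (\<lambda>x. - u (- x)) (\<lambda>x. g (- x))"
proof -
  have g: "set_integrable lborel {l..r} g" using u by (simp only: primitive_on_def)
  have "- u (- x) = - u (- (- r)) + (LBINT t:{-r..x}. g (- t))" if "x \<in> {-r..-l}" for x
  proof -
    have x: "l \<le> - x" "- x \<le> r" "l \<le> r" using that by auto
    have "(LBINT t:{-r..x}. g (- t)) = (LBINT t:{-x..r}. g t)"
      using LBINT_reflect[of "-r" x g] by simp
    moreover have "(LBINT t:{-x..r}. g t) = u r - u (- x)"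
      using primitive_on_integral[OF primitive_on_restrict_left[OF u x(1,2)] x(2)] .
    ultimately show ?thesis by simp
  qed
  then show ?thesis
    unfolding primitive_on_def by (intro conjI ballI set_integrable_reflect g)
qed

section \<open>Weak derivatives on an interval\<close>

text \<open>
  Intervals have finite length, so \<open>|g| \<le> 1 + g\<^sup>2\<close> is an integrable bound.
\<close>

lemma L2_on_imp_set_integrable:
  assumes "L2_on {l<..<r} g"
  shows "set_integrable lborel {l..r} g" "set_integrable lborel {l..r} (\<lambda>x. (g x)\<^sup>2)"
proof -
  show g2: "set_integrable lborel {l..r} (\<lambda>x. (g x)\<^sup>2)"
    using assms by (simp add: L2_on_def set_integrable_open_iff_closed)
  have g2o: "set_integrable lborel {l<..<r} (\<lambda>x. 1 + (g x)\<^sup>2)"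
    unfolding set_integrable_open_iff_closed
    by (intro set_integral_add(1) g2 borel_integrable_atLeastAtMost' continuous_intros)
  have "set_integrable lborel {l<..<r} g"
  proof (rule set_integrable_bound[OF g2o])
    show "set_borel_measurable lborel {l<..<r} g" using assms by (simp add: L2_on_def)
    have "\<bar>y\<bar> \<le> \<bar>1 + y\<^sup>2\<bar>" for y :: real
    proof -
      have "0 \<le> (\<bar>y\<bar> - 1)\<^sup>2 + 1 + y\<^sup>2" by simp
      also have "\<dots> = 2 * (1 + y\<^sup>2 - \<bar>y\<bar>)" by (simp add: power2_eq_square algebra_simps)
      finally show ?thesis by simp
    qed
    then show "AE x in lborel. x \<in> {l<..<r} \<longrightarrow> norm (g x) \<le> norm (1 + (g x)\<^sup>2)"
      by simp
  qed
  then show "set_integrable lborel {l..r} g"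
    by (simp add: set_integrable_open_iff_closed)
qed

text \<open>
  The lemma of du Bois-Reymond. If \<open>G\<close> is the primitive of \<open>g\<close>, then \<open>h = u - G\<close> has weak derivative
  0. Testing with the primitive of \<open>(h - m) e\<close>, where \<open>e\<close> is a bump function and \<open>m\<close> is the \<open>e\<close>-weighted
  mean of \<open>h\<close>, gives \<open>\<integral> (h - m)\<^sup>2 e = 0\<close>. So \<open>h\<close> is constant wherever \<open>e\<close> is positive.
\<close>

lemma weak_deriv_primitive_on:
  assumes c: "0 < c" and u: "continuous_on {-c..c} u" and w: "has_weak_deriv c u g"
  shows "primitive_on (-c) c u g"
proof -
  have g: "set_integrable lborel {-c..c} g"
    using w L2_on_imp_set_integrable(1) by (simp add: has_weak_deriv_def)
  define G where "G x = (LBINT t:{-c..x}. g t)" for x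
  have G: "primitive_on (-c) c G g"
    unfolding G_def[abs_def] by (rule primitive_on_lborel_integral[OF g])
  have cG: "continuous_on {-c..c} G" by (rule primitive_on_continuous[OF G])
  \<comment> \<open>The argument is clamped to \<open>[-c, c]\<close>, which makes \<open>h\<close> continuous on the whole line.\<close>
  define h where "h x = u (max (-c) (min c x)) - G (max (-c) (min c x))" for x
  have ch: "continuous_on S h" for S
    unfolding h_def
    by (intro continuous_intros continuous_on_compose2[OF u] continuous_on_compose2[OF cG]) (use c in auto)
  have hx: "h x = u x - G x" if "x \<in> {-c..c}" for x
    using that by (simp add: h_def)
  have local_const: "\<exists>m. \<forall>x\<in>{\<alpha><..<\<beta>}. h x = m" if ab: "-c < \<alpha>" "\<alpha> < \<beta>" "\<beta> < c" for \<alpha> \<beta>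
  proof -
    define e where "e t = max 0 ((t - \<alpha>) * (\<beta> - t))" for t
    have ce: "continuous_on S e" for S
      unfolding e_def by (intro continuous_intros)
    have e0: "e t \<ge> 0" for t by (simp add: e_def)
    have e_out: "e t = 0" if "t \<notin> {\<alpha><..<\<beta>}" for t
      using that ab by (auto simp: e_def max_def mult_le_0_iff zero_le_mult_iff not_less)
    have e_in: "e t > 0" if "t \<in> {\<alpha><..<\<beta>}" for t
      using that by (simp add: e_def less_max_iff_disj)
    have int: "f integrable_on {-c..c}" if "continuous_on {-c..c} f" for f :: "real \<Rightarrow> real"
      using that by (rule integrable_continuous_interval)
    have "integral {-c..c} e \<noteq> 0"
    proof
      assume "integral {-c..c} e = 0"
      then have "\<forall>x\<in>{-c..c}. e x = 0"
        using integral_eq_0_iff[OF ce, of "-c" c] c e0 by auto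
      moreover have "(\<alpha> + \<beta>) / 2 \<in> {-c..c}" "(\<alpha> + \<beta>) / 2 \<in> {\<alpha><..<\<beta>}" using ab by auto
      ultimately show False using e_in[of "(\<alpha> + \<beta>) / 2"] by auto
    qed
    \<comment> \<open>With this mean, the integral of \<open>k\<close> vanishes, so its primitive \<open>\<psi>\<close> has compact support.\<close>
    define m where "m = integral {-c..c} (\<lambda>t. h t * e t) / integral {-c..c} e"
    define k where "k t = (h t - m) * e t" for t
    have ck: "continuous_on S k" for S
      unfolding k_def by (intro continuous_intros ch ce)
    have k_out: "k t = 0" if "t \<notin> {\<alpha><..<\<beta>}" for t
      using e_out[OF that] by (simp add: k_def)
    have "integral {-c..c} k = integral {-c..c} (\<lambda>t. h t * e t - m * e t)"
      by (simp add: k_def[abs_def] algebra_simps)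
    also have "\<dots> = integral {-c..c} (\<lambda>t. h t * e t) - m * integral {-c..c} e"
      by (subst integral_diff) (auto intro!: int continuous_intros ch ce)
    finally have k_int: "integral {-c..c} k = 0"
      using \<open>integral {-c..c} e \<noteq> 0\<close> by (simp add: m_def)
    define \<psi> where "\<psi> x = integral {-c..x} k" for x
    have \<psi>_left: "\<psi> x = 0" if "x \<le> \<alpha>" for x
    proof -
      have "\<psi> x = integral {-c..x} (\<lambda>x. 0)"
        unfolding \<psi>_def by (rule integral_cong) (use that in \<open>auto intro: k_out\<close>)
      then show ?thesis by simp
    qed
    have \<psi>_right: "\<psi> x = 0" if "\<beta> \<le> x" for x
    proof -
      have z: "integral {\<beta>..y} k = 0" for y
      proof -
        have "integral {\<beta>..y} k = integral {\<beta>..y} (\<lambda>x. 0)"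
          by (rule integral_cong) (auto intro: k_out)
        then show ?thesis by simp
      qed
      have "integral {-c..y} k = integral {-c..\<beta>} k" if "\<beta> \<le> y" for y
        using Henstock_Kurzweil_Integration.integral_combine[of "-c" \<beta> y k] z ab that
          integrable_continuous_interval[OF ck] by simp
      from this[OF that] this[of c] k_int ab show ?thesis by (simp add: \<psi>_def)
    qed
    have \<psi>': "(\<psi> has_vector_derivative k x) (at x)" for x
    proof (cases "x < \<alpha>")
      case True
      have "((\<lambda>x. 0) has_vector_derivative k x) (at x)"
        using True k_out[of x] by simp
      then show ?thesis
        by (rule has_vector_derivative_transform_within_open[where S = "{..<\<alpha>}"])
          (use True \<psi>_left in auto)
    next
      case False
      have "((\<lambda>x. integral {-c..x} k) has_vector_derivative k x) (at x within {-c..x+1})"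
        by (rule integral_has_vector_derivative[OF ck]) (use False ab in auto)
      then have "((\<lambda>x. integral {-c..x} k) has_vector_derivative k x) (at x within {-c<..<x+1})"
        by (rule has_vector_derivative_within_subset) auto
      then show ?thesis
        unfolding \<psi>_def[abs_def] using False ab
        by (subst (asm) has_vector_derivative_within_open) auto
    qed
    have "test_function {-c<..<c} \<psi>"
      unfolding test_function_def C1_differentiable_on_def
    proof (intro conjI exI)
      show "\<forall>x\<in>UNIV. (\<psi> has_vector_derivative k x) (at x)" using \<psi>' by simp
      show "continuous_on UNIV k" by (rule ck)
      show "compact {\<alpha>..\<beta>}" by simp
      show "{\<alpha>..\<beta>} \<subseteq> {-c<..<c}" using ab by auto
      show "\<forall>x. x \<notin> {\<alpha>..\<beta>} \<longrightarrow> \<psi> x = 0" using \<psi>_left \<psi>_right by force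
    qed
    moreover have "deriv \<psi> = k"
      using \<psi>' by (auto simp: fun_eq_iff has_real_derivative_iff_has_vector_derivative intro: DERIV_imp_deriv)
    ultimately have weak: "(LBINT x:{-c..c}. u x * k x) = - (LBINT x:{-c..c}. g x * \<psi> x)"
      using w by (auto simp: has_weak_deriv_def set_integral_open_eq_closed)
    have "primitive_on (-c) c \<psi> k"
      by (rule primitive_on_C1) (auto intro: has_vector_derivative_at_within \<psi>' ck)
    then have "primitive_on (-c) c (\<lambda>x. G x * \<psi> x) (\<lambda>x. G x * k x + \<psi> x * g x)"
      by (rule primitive_on_mult[OF G])
    then have "(LBINT x:{-c..c}. G x * k x + \<psi> x * g x) = G c * \<psi> c - G (-c) * \<psi> (-c)"
      by (rule primitive_on_integral) (use c in simp)
    also have "\<dots> = 0" using \<psi>_left[of "-c"] \<psi>_right[of c] ab by simp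
    finally have "(LBINT x:{-c..c}. G x * k x + \<psi> x * g x) = 0" .
    have c\<psi>: "continuous_on {-c..c} \<psi>"
      by (rule continuous_on_vector_derivative) (auto intro: has_vector_derivative_at_within \<psi>')
    have i: "set_integrable lborel {-c..c} (\<lambda>x. G x * k x)" "set_integrable lborel {-c..c} (\<lambda>x. \<psi> x * g x)"
      "set_integrable lborel {-c..c} (\<lambda>x. u x * k x)"
      by (intro borel_integrable_atLeastAtMost' set_integrable_mult_continuous continuous_intros cG u ck c\<psi> g)+
    have "(LBINT x:{-c..c}. G x * k x) + (LBINT x:{-c..c}. \<psi> x * g x) = 0"
      using \<open>(LBINT x:{-c..c}. G x * k x + \<psi> x * g x) = 0\<close> set_integral_add(2)[OF i(1,2)] by simp
    moreover have "(LBINT x:{-c..c}. u x * k x - G x * k x) = (LBINT x:{-c..c}. u x * k x) - (LBINT x:{-c..c}. G x * k x)"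
      by (rule set_integral_diff(2)[OF i(3,1)])
    ultimately have 0: "(LBINT x:{-c..c}. u x * k x - G x * k x) = 0"
      using weak by (simp add: mult.commute)
    have "integral {-c..c} (\<lambda>x. (h x - m) * k x) = integral {-c..c} (\<lambda>x. (u x * k x - G x * k x) - m * k x)"
      by (rule integral_cong) (simp add: hx algebra_simps)
    also have "\<dots> = integral {-c..c} (\<lambda>x. u x * k x - G x * k x) - integral {-c..c} (\<lambda>x. m * k x)"
      by (rule integral_diff) (intro int continuous_intros u cG ck)+
    also have "\<dots> = 0"
      using 0 set_borel_integral_eq_integral(2)[OF set_integral_diff(1)[OF i(3,1)]] k_int by simp
    finally have "integral {-c..c} (\<lambda>x. (h x - m) * k x) = 0" .
    moreover have "(h x - m) * k x \<ge> 0" for x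
      using e0[of x] by (simp add: k_def mult.assoc[symmetric] zero_le_mult_iff)
    moreover have "continuous_on {-c..c} (\<lambda>x. (h x - m) * k x)"
      by (intro continuous_intros ch ck)
    ultimately have "\<forall>x\<in>{-c..c}. (h x - m) * k x = 0"
      using integral_eq_0_iff[of "-c" c "\<lambda>x. (h x - m) * k x"] c by auto
    have "h x = m" if x: "x \<in> {\<alpha><..<\<beta>}" for x
    proof -
      have "x \<in> {-c..c}" using x ab by simp
      with \<open>\<forall>x\<in>{-c..c}. (h x - m) * k x = 0\<close> have "(h x - m) * k x = 0" by (rule bspec)
      then show ?thesis using e_in[OF x] by (simp add: k_def)
    qed
    then show ?thesis by (intro exI ballI)
  qed
  have const_open: "h x = h 0" if x: "x \<in> {-c<..<c}" for x
  proof -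
    have "-c < (min 0 x - c) / 2" "(min 0 x - c) / 2 < (max 0 x + c) / 2" "(max 0 x + c) / 2 < c"
      using x c by auto
    from local_const[OF this] obtain m
      where m: "\<forall>y\<in>{(min 0 x - c) / 2<..<(max 0 x + c) / 2}. h y = m" by (rule exE)
    have "x \<in> {(min 0 x - c) / 2<..<(max 0 x + c) / 2}" "0 \<in> {(min 0 x - c) / 2<..<(max 0 x + c) / 2}"
      using x c by auto
    then show ?thesis using bspec[OF m] by simp
  qed
  have const: "h x = h 0" if "x \<in> {-c..c}" for x
    by (rule continuous_constant_on_closure[OF ch const_open, of "{-c<..<c}"]) (use that c in auto)
  have "u x = u (-c) + G x" if "x \<in> {-c..c}" for x
  proof -
    have "G (-c) = 0"
      using primitive_onD[OF G order.refl] c unfolding G_def by linarith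
    moreover have "h (-c) = h 0" "h (-c) = u (-c) - G (-c)"
      using const[of "-c"] hx[of "-c"] c by simp_all
    ultimately show ?thesis
      using const[OF that] hx[OF that] by linarith
  qed
  then show ?thesis
    unfolding primitive_on_def G_def by (intro conjI ballI g)
qed

section \<open>Picone's inequality\<close>

text \<open>
  A positive solution \<open>z\<close> of \<open>(b z')' + v z = 0\<close> with flux \<open>p = b z'\<close> gives a solution \<open>q = p/z\<close> of the
  Riccati equation \<open>q' = - v - q\<^sup>2/b\<close>. Then \<open>b g\<^sup>2 - v u\<^sup>2 - (q u\<^sup>2)' = b (g - q u/b)\<^sup>2 \<ge> 0\<close>.
\<close>

lemma picone_inequality:
  fixes u g b v z p :: "real \<Rightarrow> real"
  assumes u: "primitive_on l r u g" and g2: "set_integrable lborel {l..r} (\<lambda>x. (g x)\<^sup>2)"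
    and "l \<le> r" and ul: "u l = 0"
    and b: "continuous_on {l..r} b" "\<And>x. x \<in> {l..r} \<Longrightarrow> b x > 0"
    and v: "continuous_on {l..r} v"
    and z_pos: "\<And>x. x \<in> {l..r} \<Longrightarrow> z x > 0"
    and z: "\<And>x. x \<in> {l..r} \<Longrightarrow> (z has_real_derivative p x / b x) (at x)"
    and p: "\<And>x. x \<in> {l..r} \<Longrightarrow> (p has_real_derivative - v x * z x) (at x)"
  shows "p r / z r * (u r)\<^sup>2 \<le> (LBINT x:{l..r}. b x * (g x)\<^sup>2 - v x * (u x)\<^sup>2)"
proof -
  let ?q = "\<lambda>x. p x / z x" and ?q' = "\<lambda>x. - v x - (p x / z x)\<^sup>2 / b x"
  have cu: "continuous_on {l..r} u"
    by (rule primitive_on_continuous[OF u])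
  have cz: "continuous_on {l..r} z" and cp: "continuous_on {l..r} p"
    by (rule DERIV_continuous_on[OF has_field_derivative_at_within[OF z]], assumption,
        rule DERIV_continuous_on[OF has_field_derivative_at_within[OF p]], assumption)
  have nz: "\<forall>x\<in>{l..r}. z x \<noteq> 0" "\<forall>x\<in>{l..r}. b x \<noteq> 0"
    using z_pos b(2) by force+
  have cq: "continuous_on {l..r} ?q'"
    by (intro continuous_intros cz cp b(1) v) (use nz in auto)
  have "(?q has_real_derivative ?q' x) (at x)" if x: "x \<in> {l..r}" for x
  proof -
    have "z x > 0" "b x > 0" using z_pos b(2) x by auto
    then have "((- v x * z x) * z x - p x * (p x / b x)) / (z x * z x) = ?q' x"
      by (simp add: field_simps power2_eq_square)
    then show ?thesis
      using DERIV_divide[OF p[OF x] z[OF x]] \<open>z x > 0\<close> by simp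
  qed
  then have "(?q has_vector_derivative ?q' x) (at x within {l..r})" if "x \<in> {l..r}" for x
    using that by (simp only: has_vector_derivative_at_within has_real_derivative_iff_has_vector_derivative)
  then have q: "primitive_on l r ?q ?q'"
    by (rule primitive_on_C1[OF _ cq])
  let ?d = "\<lambda>x. ?q x * (u x * g x + u x * g x) + (u x * u x) * ?q' x"
  have d: "primitive_on l r (\<lambda>x. ?q x * (u x * u x)) ?d"
    by (rule primitive_on_mult[OF q primitive_on_mult[OF u u]])
  have "p r / z r * (u r)\<^sup>2 = (LBINT x:{l..r}. ?d x)"
    using primitive_on_integral[OF d \<open>l \<le> r\<close>] ul by (simp add: power2_eq_square)
  also have "\<dots> \<le> (LBINT x:{l..r}. b x * (g x)\<^sup>2 - v x * (u x)\<^sup>2)"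
  proof (rule set_integral_mono)
    show "set_integrable lborel {l..r} ?d"
      using d by (simp add: primitive_on_def)
    show "set_integrable lborel {l..r} (\<lambda>x. b x * (g x)\<^sup>2 - v x * (u x)\<^sup>2)"
      by (intro set_integral_diff(1) set_integrable_mult_continuous g2 b(1)
          borel_integrable_atLeastAtMost' continuous_intros v cu)
    fix x assume x: "x \<in> {l..r}"
    have "b x > 0" using b(2) x by auto
    have square: "B * G\<^sup>2 - V * U\<^sup>2 - (Q * (U * G + U * G) + (U * U) * (- V - Q\<^sup>2 / B)) = B * (G - Q * U / B)\<^sup>2"
      if "B > 0" for B G V U Q :: real
      using that by (simp add: field_simps power2_eq_square)
    have "b x * (g x)\<^sup>2 - v x * (u x)\<^sup>2 - ?d x = b x * (g x - ?q x * u x / b x)\<^sup>2"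
      by (rule square[OF \<open>b x > 0\<close>])
    also have "\<dots> \<ge> 0" using \<open>b x > 0\<close> by simp
    finally show "?d x \<le> b x * (g x)\<^sup>2 - v x * (u x)\<^sup>2"
      by (simp only: diff_ge_0_iff_ge)
  qed
  finally show ?thesis .
qed

section \<open>The profile functions of the catenoid\<close>

locale catenoid =
  fixes a :: real
  assumes a_gt: "a > 1 / 2"
begin

abbreviation "A \<equiv> cat_A a"
abbreviation "B \<equiv> cat_B a"
abbreviation "K \<equiv> cat_K a"
abbreviation "\<phi> \<equiv> cat_phi a"
abbreviation "s\<^sub>0 \<equiv> cat_s0 a"

text \<open>
  \<open>D\<close> is the common value of \<open>A A'\<close> and \<open>B B'\<close>. The Jacobi equation and the Robin condition
  reduce to polynomial identities in \<open>A\<close>, \<open>B\<close>, \<open>D\<close> and \<open>K\<close> modulo \<open>A\<^sup>2 = B\<^sup>2 + 1\<close> and \<open>D\<^sup>2 = A\<^sup>2 B\<^sup>2 - K\<^sup>2\<close>.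
\<close>

definition D :: "real \<Rightarrow> real"
  where "D s = a * sinh (2 * s)"

lemma cosh_bound: "a * cosh (2 * s) > 1 / 2"
proof -
  have "a * 1 \<le> a * cosh (2 * s)"
    using a_gt cosh_real_ge_1 by (intro mult_left_mono) auto
  then show ?thesis using a_gt by linarith
qed

lemma A_pos: "A s > 0" and B_pos: "B s > 0" and K_pos: "K > 0"
proof -
  show "A s > 0" "B s > 0"
    using cosh_bound[of s] by (simp_all add: cat_A_def cat_B_def)
  have "(1/2)\<^sup>2 < a\<^sup>2" using a_gt by (intro power_strict_mono) auto
  then show "K > 0" by (simp add: cat_K_def power2_eq_square)
qed

lemma A_sq: "(A s)\<^sup>2 = a * cosh (2 * s) + 1 / 2" and B_sq: "(B s)\<^sup>2 = a * cosh (2 * s) - 1 / 2"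
  using cosh_bound[of s] by (simp_all add: cat_A_def cat_B_def)

lemma A_sq_B: "(A s)\<^sup>2 = (B s)\<^sup>2 + 1"
  by (simp add: A_sq B_sq)

lemma A_gt_1: "A s > 1"
proof -
  have "1\<^sup>2 < (A s)\<^sup>2" using B_pos[of s] by (simp add: A_sq_B)
  then show ?thesis by (rule power2_less_imp_less) (use A_pos[of s] in simp)
qed

lemma D_sq: "(D s)\<^sup>2 = (A s)\<^sup>2 * (B s)\<^sup>2 - K\<^sup>2"
proof -
  have "K\<^sup>2 = a\<^sup>2 - 1 / 4"
    using a_gt K_pos by (simp add: cat_K_def)
  moreover have "(cosh (2 * s))\<^sup>2 = 1 + (sinh (2 * s))\<^sup>2"
    by (simp add: cosh_square_eq)
  ultimately show ?thesis
    unfolding A_sq B_sq D_def by (simp add: power2_eq_square algebra_simps)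
qed

lemma D_pos: "s > 0 \<Longrightarrow> D s > 0" and D_nonneg: "s \<ge> 0 \<Longrightarrow> D s \<ge> 0"
  using a_gt by (simp_all add: D_def)

lemma
  has_deriv_A: "(A has_real_derivative D s / A s) (at s)" and
  has_deriv_B: "(B has_real_derivative D s / B s) (at s)" and
  has_deriv_D: "(D has_real_derivative (A s)\<^sup>2 + (B s)\<^sup>2) (at s)"
proof -
  have pos: "a * cosh (2 * s) + 1 / 2 > 0" "a * cosh (2 * s) - 1 / 2 > 0"
    using cosh_bound[of s] by simp_all
  have "((\<lambda>s. a * cosh (2 * s) + 1 / 2) has_real_derivative 2 * D s) (at s)"
    "((\<lambda>s. a * cosh (2 * s) - 1 / 2) has_real_derivative 2 * D s) (at s)"
    by (auto intro!: derivative_eq_intros simp: D_def)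
  from DERIV_chain2[where g = "\<lambda>s. a * cosh (2 * s) + 1 / 2", OF DERIV_real_sqrt[OF pos(1)] this(1)]
    DERIV_chain2[where g = "\<lambda>s. a * cosh (2 * s) - 1 / 2", OF DERIV_real_sqrt[OF pos(2)] this(2)]
  show "(A has_real_derivative D s / A s) (at s)" "(B has_real_derivative D s / B s) (at s)"
    unfolding cat_A_def[abs_def] cat_B_def[abs_def] by (simp_all add: field_simps)
  show "(D has_real_derivative (A s)\<^sup>2 + (B s)\<^sup>2) (at s)"
    unfolding D_def[abs_def] A_sq B_sq
    by (auto intro!: derivative_eq_intros)
qed

lemma continuous_on_AB: "continuous_on S A" "continuous_on S B" "continuous_on S D"
  by (rule DERIV_continuous_on[OF has_field_derivative_at_within[OF has_deriv_A]]
      DERIV_continuous_on[OF has_field_derivative_at_within[OF has_deriv_B]]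
      DERIV_continuous_on[OF has_field_derivative_at_within[OF has_deriv_D]])+

lemma has_deriv_phi: "(\<phi> has_real_derivative K / ((A s)\<^sup>2 * B s)) (at s)"
proof -
  let ?f = "\<lambda>t. K / ((A t)\<^sup>2 * B t)"
  have c: "continuous_on S ?f" for S
    by (intro continuous_intros continuous_on_AB) (use A_pos B_pos in \<open>auto simp: less_imp_neq[THEN not_sym]\<close>)
  define m where "m = \<bar>s\<bar> + 1"
  have "((\<lambda>u. LBINT y=0..u. ?f y) has_vector_derivative ?f s) (at s within {-m..m})"
    by (rule interval_integral_FTC2[of "-m" 0 m, folded zero_ereal_def]) (auto simp: m_def c)
  then have "((\<lambda>u. LBINT y=0..u. ?f y) has_vector_derivative ?f s) (at s within {-m<..<m})"
    by (rule has_vector_derivative_within_subset) auto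
  then have "((\<lambda>u. LBINT y=0..u. ?f y) has_vector_derivative ?f s) (at s)"
    by (subst (asm) has_vector_derivative_within_open) (auto simp: m_def)
  then show ?thesis
    by (simp add: has_real_derivative_iff_has_vector_derivative cat_phi_def[abs_def])
qed

lemma continuous_on_phi: "continuous_on S \<phi>"
  by (rule DERIV_continuous_on[OF has_field_derivative_at_within[OF has_deriv_phi]])

lemma phi_0: "\<phi> 0 = 0"
  by (simp add: cat_phi_def zero_ereal_def[symmetric])

lemma phi_strict_mono:
  assumes "s < t" shows "\<phi> s < \<phi> t"
proof (rule DERIV_pos_imp_increasing[OF assms])
  fix x
  have "K / ((A x)\<^sup>2 * B x) > 0"
    using A_pos[of x] B_pos[of x] K_pos by simp
  then show "\<exists>y. (\<phi> has_real_derivative y) (at x) \<and> 0 < y"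
    using has_deriv_phi by blast
qed

lemma phi_nonneg: "s \<ge> 0 \<Longrightarrow> \<phi> s \<ge> 0"
  using phi_strict_mono[of 0 s] by (cases "s = 0") (auto simp: phi_0)

lemma B_mono:
  assumes "\<bar>s\<bar> \<le> t" shows "B s \<le> B t"
proof -
  have "cosh (2 * \<bar>s\<bar>) \<le> cosh (2 * t)"
    using assms by (intro cosh_real_nonneg_le_iff[THEN iffD2]) auto
  moreover have "cosh (2 * \<bar>s\<bar>) = cosh (2 * s)"
    by (simp add: abs_if)
  ultimately show ?thesis
    using a_gt by (simp add: cat_B_def)
qed

lemma continuous_on_W: "continuous_on S (W a k)"
  unfolding W_def[abs_def] II_sq_def
  by (intro continuous_intros continuous_on_AB) (use B_pos in \<open>auto simp: less_imp_neq[THEN not_sym]\<close>)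

lemma B_even: "B (- s) = B s" and W_even: "W a k (- s) = W a k s"
  by (simp_all add: cat_B_def W_def II_sq_def)

lemma W_mode: "B s * W a 1 s = B s * W a k s + ((real_of_int k)\<^sup>2 - 1) / B s"
  using B_pos[of s] by (simp add: W_def field_simps power2_eq_square)

section \<open>The free boundary condition\<close>

text \<open>
  This unfolds the definite description of \<open>s\<^sub>0\<close>. A root exists by the intermediate value theorem, since
  \<open>BK/D\<close> tends to 0 at infinity while \<open>tanh \<phi>\<close> stays away from 0. It is unique because \<open>tanh \<phi>\<close>
  increases and \<open>BK/D\<close> decreases: \<open>(B/D)' = - (K\<^sup>2 + B\<^sup>4)/(B D\<^sup>2)\<close>.
\<close>

lemma s0_properties:
  "s\<^sub>0 > 0" "tanh (\<phi> s\<^sub>0) = B s\<^sub>0 * K / D s\<^sub>0"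
proof -
  let ?G = "\<lambda>s. tanh (\<phi> s) * D s - B s * K"
  define \<tau> where "\<tau> = tanh (\<phi> 1)"
  have \<tau>: "\<tau> > 0" using phi_strict_mono[of 0 1] by (simp add: \<tau>_def phi_0)
  \<comment> \<open>This value makes \<open>\<tau>\<^sup>2 D\<^sup>2 > B\<^sup>2 K\<^sup>2\<close> at \<open>M\<close>, because \<open>D\<^sup>2\<close> grows like the square of \<open>cosh 2s\<close> and \<open>B\<^sup>2\<close>
    only like \<open>cosh 2s\<close>.\<close>
  define M where "M = max 2 (2 * K\<^sup>2 / (\<tau>\<^sup>2 * a))"
  have M: "M \<ge> 2" by (simp add: M_def)
  define c where "c = cosh (2 * M)"
  have c_M: "c > M"
  proof -
    have "1 + 2 * M + 0 < exp (2 * M) + exp (- (2 * M))"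
      by (intro add_le_less_mono exp_ge_add_one_self exp_gt_zero)
    then show ?thesis by (simp add: c_def cosh_field_def)
  qed
  have "c > 2" "c > 2 * K\<^sup>2 / (\<tau>\<^sup>2 * a)" using c_M by (auto simp: M_def)
  then have 2: "\<tau>\<^sup>2 * a * c > 2 * K\<^sup>2"
    using \<tau> a_gt by (simp add: field_simps)
  have "c\<^sup>2 \<ge> 2"
    using \<open>c > 2\<close> power_mono[of 2 c 2] by simp
  have "(B M * K)\<^sup>2 \<le> (a * c) * K\<^sup>2"
    unfolding power_mult_distrib B_sq c_def by (intro mult_right_mono) auto
  also have "\<dots> < (a * c) * (\<tau>\<^sup>2 * a * c / 2)"
    using 2 a_gt \<open>c > 2\<close> by (intro mult_strict_left_mono) auto
  also have "\<dots> = \<tau>\<^sup>2 * a\<^sup>2 * (c\<^sup>2 / 2)" by (simp add: power2_eq_square)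
  also have "\<dots> \<le> \<tau>\<^sup>2 * a\<^sup>2 * (c\<^sup>2 - 1)"
    using \<open>c\<^sup>2 \<ge> 2\<close> by (intro mult_left_mono) auto
  also have "\<dots> = (\<tau> * D M)\<^sup>2"
    by (simp add: D_def c_def power_mult_distrib cosh_square_eq)
  finally have "B M * K < \<tau> * D M"
    using \<tau> D_nonneg[of M] by (intro power2_less_imp_less[of "B M * K"]) (auto simp: M_def)
  also have "\<dots> \<le> tanh (\<phi> M) * D M"
  proof (rule mult_right_mono)
    show "\<tau> \<le> tanh (\<phi> M)"
      using phi_strict_mono[of 1 M] M by (simp add: \<tau>_def)
  qed (use M in \<open>simp add: D_nonneg\<close>)
  finally have "?G M \<ge> 0" by simp
  have "\<exists>x. 0 \<le> x \<and> x \<le> M \<and> ?G x = 0"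
  proof (rule IVT')
    show "?G 0 \<le> 0" using B_pos[of 0] K_pos by (simp add: phi_0)
    show "continuous_on {0..M} ?G"
      by (intro continuous_intros continuous_on_AB continuous_on_phi) simp
  qed (use \<open>?G M \<ge> 0\<close> in \<open>auto simp: M_def\<close>)
  then obtain s where s: "0 \<le> s" "?G s = 0" by blast
  have "s \<noteq> 0" using s(2) B_pos[of 0] K_pos by (auto simp: phi_0)
  then have "s > 0" using s by simp
  have root: "tanh (\<phi> s) = B s * K / D s"
    using s(2) D_pos[OF \<open>s > 0\<close>] by (simp add: field_simps)
  have less: "tanh (\<phi> x) - B x * K / D x < tanh (\<phi> y) - B y * K / D y" if "0 < x" "x < y" for x y
  proof (rule DERIV_pos_imp_increasing[OF \<open>x < y\<close>])
    fix t assume t: "x \<le> t" "t \<le> y"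
    then have "D t > 0" using \<open>0 < x\<close> by (intro D_pos) simp
    let ?d = "(1 - (tanh (\<phi> t))\<^sup>2) * (K / ((A t)\<^sup>2 * B t)) - (D t / B t * K * D t - B t * K * ((A t)\<^sup>2 + (B t)\<^sup>2)) / (D t * D t)"
    have "((\<lambda>s. tanh (\<phi> s) - B s * K / D s) has_real_derivative ?d) (at t)"
      using \<open>D t > 0\<close> by (auto intro!: derivative_eq_intros has_deriv_phi has_deriv_B has_deriv_D)
    moreover have "?d > 0"
    proof -
      have "D t / B t * K * D t - B t * K * ((A t)\<^sup>2 + (B t)\<^sup>2)
          = K / B t * ((D t)\<^sup>2 - (A t)\<^sup>2 * (B t)\<^sup>2 - (B t)\<^sup>2 * (B t)\<^sup>2)"
        using B_pos[of t] by (simp add: field_simps power2_eq_square)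
      also have "\<dots> = - (K / B t * (K\<^sup>2 + (B t)\<^sup>2 * (B t)\<^sup>2))"
        by (simp add: D_sq algebra_simps)
      also have "\<dots> < 0" using B_pos[of t] K_pos by (simp add: add_nonneg_pos)
      finally have "(D t / B t * K * D t - B t * K * ((A t)\<^sup>2 + (B t)\<^sup>2)) / (D t * D t) < 0"
        using \<open>D t > 0\<close> by (simp add: divide_neg_pos)
      moreover have "(1 - (tanh (\<phi> t))\<^sup>2) * (K / ((A t)\<^sup>2 * B t)) \<ge> 0"
        using tanh_real_bounds[of "\<phi> t"] B_pos[of t] K_pos
        by (intro mult_nonneg_nonneg) (auto simp: abs_square_le_1 abs_le_iff)
      ultimately show ?thesis by simp
    qed
    ultimately show "\<exists>z. ((\<lambda>s. tanh (\<phi> s) - B s * K / D s) has_real_derivative z) (at t) \<and> 0 < z"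
      by blast
  qed
  have "s\<^sub>0 = s"
    unfolding cat_s0_def D_def[symmetric]
  proof (rule the_equality)
    show "s > 0 \<and> tanh (\<phi> s) = B s * K / D s"
      using \<open>s > 0\<close> root by simp
    fix t assume t: "t > 0 \<and> tanh (\<phi> t) = B t * K / D t"
    show "t = s"
      using less[of s t] less[of t s] t root \<open>s > 0\<close> by (cases s t rule: linorder_cases) auto
  qed
  with root \<open>s > 0\<close> show "s\<^sub>0 > 0" "tanh (\<phi> s\<^sub>0) = B s\<^sub>0 * K / D s\<^sub>0"
    by simp_all
qed

text \<open>
  The equation for \<open>s\<^sub>0\<close> in a form without \<open>\<phi>\<close>: all hyperbolic functions of \<open>\<phi>(s\<^sub>0)\<close> are expressed
  by one common factor, which cancels from every quotient taken later.
\<close>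

lemma free_boundary_ratio:
  obtains m where "m > 0" "sinh (\<phi> s\<^sub>0) = m * (B s\<^sub>0 * K)" "cosh (\<phi> s\<^sub>0) = m * D s\<^sub>0"
proof
  have D: "D s\<^sub>0 > 0" using D_pos s0_properties(1) by simp
  show "cosh (\<phi> s\<^sub>0) / D s\<^sub>0 > 0" using D cosh_real_pos by simp
  show "cosh (\<phi> s\<^sub>0) = cosh (\<phi> s\<^sub>0) / D s\<^sub>0 * D s\<^sub>0" using D by simp
  have "sinh (\<phi> s\<^sub>0) = tanh (\<phi> s\<^sub>0) * cosh (\<phi> s\<^sub>0)"
    by (simp add: tanh_def)
  then show "sinh (\<phi> s\<^sub>0) = cosh (\<phi> s\<^sub>0) / D s\<^sub>0 * (B s\<^sub>0 * K)"
    by (simp add: s0_properties(2))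
qed

lemma coth_r: "coth (cat_r a) * B s\<^sub>0 = D s\<^sub>0 / B s\<^sub>0"
proof -
  let ?x = "A s\<^sub>0 * cosh (\<phi> s\<^sub>0)"
  have "A s\<^sub>0 * 1 \<le> ?x"
    using A_pos[of s\<^sub>0] cosh_real_ge_1 by (intro mult_left_mono) auto
  then have x: "?x > 1" using A_gt_1[of s\<^sub>0] by linarith
  have "cat_r a > 0 \<and> cosh (cat_r a) = ?x"
    unfolding cat_r_def
  proof (rule theI[where a = "arcosh ?x"])
    show "arcosh ?x > 0 \<and> cosh (arcosh ?x) = ?x"
      using x by (simp add: less_le)
    fix r assume "r > 0 \<and> cosh r = ?x"
    then show "r = arcosh ?x"
      by (metis arcosh_cosh_real less_imp_le)
  qed
  then have r: "sinh (cat_r a) > 0" "cosh (cat_r a) = ?x" by simp_all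
  obtain m where m: "m > 0" "sinh (\<phi> s\<^sub>0) = m * (B s\<^sub>0 * K)" "cosh (\<phi> s\<^sub>0) = m * D s\<^sub>0"
    by (rule free_boundary_ratio)
  have "(m * D s\<^sub>0)\<^sup>2 - (m * (B s\<^sub>0 * K))\<^sup>2 = 1"
    unfolding m(2,3)[symmetric] by (rule hyperbolic_pythagoras)
  have "(sinh (cat_r a))\<^sup>2 = (A s\<^sub>0)\<^sup>2 * (m * D s\<^sub>0)\<^sup>2 - 1"
    by (simp add: sinh_square_eq r(2) m(3) power_mult_distrib)
  also have "\<dots> = (A s\<^sub>0)\<^sup>2 * (m * D s\<^sub>0)\<^sup>2 - ((m * D s\<^sub>0)\<^sup>2 - (m * (B s\<^sub>0 * K))\<^sup>2)"
    using \<open>(m * D s\<^sub>0)\<^sup>2 - (m * (B s\<^sub>0 * K))\<^sup>2 = 1\<close> by simp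
  also have "\<dots> = m\<^sup>2 * (B s\<^sub>0)\<^sup>2 * ((D s\<^sub>0)\<^sup>2 + K\<^sup>2)"
    by (simp add: A_sq_B power_mult_distrib algebra_simps)
  also have "\<dots> = (m * A s\<^sub>0 * (B s\<^sub>0)\<^sup>2)\<^sup>2"
    by (simp add: D_sq power_mult_distrib algebra_simps)
  finally have "sinh (cat_r a) = m * A s\<^sub>0 * (B s\<^sub>0)\<^sup>2"
    by (rule power2_eq_imp_eq) (use r(1) m(1) A_pos[of s\<^sub>0] B_pos[of s\<^sub>0] in simp_all)
  then show ?thesis
    using m(1) A_pos[of s\<^sub>0] B_pos[of s\<^sub>0] by (simp add: coth_def r(2) m(3) field_simps power2_eq_square)
qed

section \<open>Jacobi fields from ambient isometries\<close>

text \<open>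
  For each \<open>d\<close> the pair \<open>tilt_sinh d\<close>, \<open>tilt_cosh d\<close> satisfies the same first order system as
  \<open>sinh \<phi>\<close>, \<open>cosh \<phi>\<close>, which is all that the Jacobi equation below depends on.
\<close>

definition tilt_sinh :: "real \<Rightarrow> real \<Rightarrow> real"
  where "tilt_sinh d s = sinh (\<phi> s) + d * cosh (\<phi> s)"

definition tilt_cosh :: "real \<Rightarrow> real \<Rightarrow> real"
  where "tilt_cosh d s = cosh (\<phi> s) + d * sinh (\<phi> s)"

text \<open>
  Let \<open>N\<close> be the unit normal of the catenoid in the hyperboloid model. For \<open>d = 0\<close> this is the profile of
  the inner product of \<open>N\<close> with a rotation about an axis perpendicular to the axis of symmetry; the
  coefficient of \<open>d\<close> is the same for the hyperbolic translation along a geodesic perpendicular to that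
  axis, and is even and positive.
\<close>

definition jacobi_profile :: "real \<Rightarrow> real \<Rightarrow> real"
  where "jacobi_profile d s = K / (A s * B s) * tilt_sinh d s + D s / A s * tilt_cosh d s"

text \<open>
  This is \<open>B\<close> times the derivative of \<open>jacobi_profile d\<close>, simplified by the Weingarten equation
  \<open>N' = - (K/B\<^sup>2) X'\<close> for the position vector \<open>X\<close>.
\<close>

definition jacobi_flux :: "real \<Rightarrow> real \<Rightarrow> real"
  where "jacobi_flux d s =
    - (K * D s / (A s * (B s)\<^sup>2)) * tilt_sinh d s + (A s * B s + K\<^sup>2 / (A s * B s)) * tilt_cosh d s"

lemma has_deriv_tilt_sinh: "(tilt_sinh d has_real_derivative K / ((A s)\<^sup>2 * B s) * tilt_cosh d s) (at s)"
  unfolding tilt_sinh_def[abs_def] tilt_cosh_def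
  by (auto intro!: derivative_eq_intros has_deriv_phi simp: distrib_left add_divide_distrib mult_ac)

lemma has_deriv_tilt_cosh: "(tilt_cosh d has_real_derivative K / ((A s)\<^sup>2 * B s) * tilt_sinh d s) (at s)"
  unfolding tilt_cosh_def[abs_def] tilt_sinh_def
  by (auto intro!: derivative_eq_intros has_deriv_phi simp: distrib_left add_divide_distrib mult_ac)

lemma has_deriv_jacobi_profile: "(jacobi_profile d has_real_derivative jacobi_flux d s / B s) (at s)"
proof -
  let ?A = "A s" and ?B = "B s" and ?D = "D s" and ?S = "tilt_sinh d s" and ?C = "tilt_cosh d s"
  have pos: "?A > 0" "?B > 0" by (rule A_pos B_pos)+
  let ?\<alpha>' = "- K * ?D * (?A\<^sup>2 + ?B\<^sup>2) / (?A ^ 3 * ?B ^ 3)"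
  let ?\<beta>' = "(?A\<^sup>2 + ?B\<^sup>2) / ?A - ?D\<^sup>2 / ?A ^ 3"
  have \<alpha>: "((\<lambda>s. K / (A s * B s)) has_real_derivative ?\<alpha>') (at s)"
    using pos by (auto intro!: derivative_eq_intros has_deriv_A has_deriv_B simp: divide_simps)
      (simp_all add: power2_eq_square power3_eq_cube algebra_simps)
  have \<beta>: "((\<lambda>s. D s / A s) has_real_derivative ?\<beta>') (at s)"
    using pos by (auto intro!: derivative_eq_intros has_deriv_A has_deriv_D simp: divide_simps)
      (simp_all add: power2_eq_square power3_eq_cube algebra_simps)
  let ?f = "K / (?A\<^sup>2 * ?B)"
  have "(jacobi_profile d has_real_derivative
      (?\<alpha>' * ?S + ?f * ?C * (K / (?A * ?B))) + (?\<beta>' * ?C + ?f * ?S * (?D / ?A))) (at s)"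
    unfolding jacobi_profile_def[abs_def]
    by (intro DERIV_add DERIV_mult \<alpha> \<beta> has_deriv_tilt_sinh has_deriv_tilt_cosh)
  moreover have "(?\<alpha>' * ?S + ?f * ?C * (K / (?A * ?B))) + (?\<beta>' * ?C + ?f * ?S * (?D / ?A)) =
      (?\<alpha>' + ?f * (?D / ?A)) * ?S + (?f * (K / (?A * ?B)) + ?\<beta>') * ?C"
    by (simp only: algebra_simps)
  moreover have "?\<alpha>' + ?f * (?D / ?A) = - (K * ?D / (?A * ?B\<^sup>2)) / ?B"
    using pos by (simp add: divide_simps) (simp add: power2_eq_square power3_eq_cube algebra_simps)
  moreover have "?f * (K / (?A * ?B)) + ?\<beta>' = (?A * ?B + K\<^sup>2 / (?A * ?B)) / ?B"
  proof -
    have "?f * (K / (?A * ?B)) + ?\<beta>' = (K\<^sup>2 + ?A\<^sup>2 * ?B\<^sup>2 * (?A\<^sup>2 + ?B\<^sup>2) - ?D\<^sup>2 * ?B\<^sup>2) / (?A ^ 3 * ?B\<^sup>2)"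
      using pos by (simp add: divide_simps) (simp add: power2_eq_square power3_eq_cube algebra_simps)
    also have "K\<^sup>2 + ?A\<^sup>2 * ?B\<^sup>2 * (?A\<^sup>2 + ?B\<^sup>2) - ?D\<^sup>2 * ?B\<^sup>2 = ?A\<^sup>2 * (?A\<^sup>2 * ?B\<^sup>2 + K\<^sup>2)"
      by (simp add: D_sq A_sq_B algebra_simps)
    also have "\<dots> / (?A ^ 3 * ?B\<^sup>2) = (?A * ?B + K\<^sup>2 / (?A * ?B)) / ?B"
      using pos by (simp add: divide_simps) (simp add: power2_eq_square power3_eq_cube algebra_simps)
    finally show ?thesis .
  qed
  moreover have "(- (K * ?D / (?A * ?B\<^sup>2)) / ?B) * ?S + ((?A * ?B + K\<^sup>2 / (?A * ?B)) / ?B) * ?C = jacobi_flux d s / ?B"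
    by (simp only: jacobi_flux_def add_divide_distrib[of "_ * tilt_sinh d s"] times_divide_eq_left)
  ultimately show ?thesis
    by (simp only:)
qed

text \<open>
  The radial Jacobi equation of mode 1. The coefficients of \<open>tilt_sinh\<close> and \<open>tilt_cosh\<close> are compared
  separately.
\<close>

lemma has_deriv_jacobi_flux: "(jacobi_flux d has_real_derivative - (B s * W a 1 s) * jacobi_profile d s) (at s)"
proof -
  let ?A = "A s" and ?B = "B s" and ?D = "D s" and ?S = "tilt_sinh d s" and ?C = "tilt_cosh d s"
  have pos: "?A > 0" "?B > 0" by (rule A_pos B_pos)+
  let ?\<gamma>' = "- K * (?A\<^sup>2 + ?B\<^sup>2) / (?A * ?B\<^sup>2) + K * ?D\<^sup>2 / (?A ^ 3 * ?B\<^sup>2) + 2 * K * ?D\<^sup>2 / (?A * ?B ^ 4)"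
  let ?\<delta>' = "?D * ?B / ?A + ?A * ?D / ?B - K\<^sup>2 * ?D * (?A\<^sup>2 + ?B\<^sup>2) / (?A ^ 3 * ?B ^ 3)"
  have \<gamma>: "((\<lambda>s. - (K * D s / (A s * (B s)\<^sup>2))) has_real_derivative ?\<gamma>') (at s)"
    using pos by (auto intro!: derivative_eq_intros has_deriv_A has_deriv_B has_deriv_D simp: divide_simps)
      (simp_all add: eval_nat_numeral algebra_simps)
  have \<delta>: "((\<lambda>s. A s * B s + K\<^sup>2 / (A s * B s)) has_real_derivative ?\<delta>') (at s)"
  proof -
    have "((\<lambda>s. K\<^sup>2 / (A s * B s)) has_real_derivative - K\<^sup>2 * ?D * (?A\<^sup>2 + ?B\<^sup>2) / (?A ^ 3 * ?B ^ 3)) (at s)"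
      using pos by (auto intro!: derivative_eq_intros has_deriv_A has_deriv_B simp: divide_simps)
        (simp_all add: eval_nat_numeral algebra_simps)
    from DERIV_add[OF DERIV_mult[OF has_deriv_A has_deriv_B] this] show ?thesis
      by (rule DERIV_cong) simp
  qed
  let ?f = "K / (?A\<^sup>2 * ?B)"
  have deriv: "(jacobi_flux d has_real_derivative
      (?\<gamma>' * ?S + ?f * ?C * (- (K * ?D / (?A * ?B\<^sup>2)))) + (?\<delta>' * ?C + ?f * ?S * (?A * ?B + K\<^sup>2 / (?A * ?B)))) (at s)"
    unfolding jacobi_flux_def[abs_def]
    by (intro DERIV_add DERIV_mult \<gamma> \<delta> has_deriv_tilt_sinh has_deriv_tilt_cosh)
  have eq: "(?\<gamma>' * ?S + ?f * ?C * (- (K * ?D / (?A * ?B\<^sup>2)))) + (?\<delta>' * ?C + ?f * ?S * (?A * ?B + K\<^sup>2 / (?A * ?B))) =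
      (?\<gamma>' + ?f * (?A * ?B + K\<^sup>2 / (?A * ?B))) * ?S + (?\<delta>' - ?f * (K * ?D / (?A * ?B\<^sup>2))) * ?C"
    by (simp only: algebra_simps)
  have W1: "?B * W a 1 s = (2 * K\<^sup>2 - 2 * ?B ^ 4 - ?B\<^sup>2) / ?B ^ 3"
    using pos by (simp add: W_def II_sq_def divide_simps) (simp add: eval_nat_numeral algebra_simps)
  have S: "?\<gamma>' + ?f * (?A * ?B + K\<^sup>2 / (?A * ?B)) = - (?B * W a 1 s) * (K / (?A * ?B))"
  proof -
    have "?\<gamma>' + ?f * (?A * ?B + K\<^sup>2 / (?A * ?B)) =
        K * (- (?A\<^sup>2 + ?B\<^sup>2) * ?A\<^sup>2 * ?B\<^sup>2 + ?D\<^sup>2 * ?B\<^sup>2 + 2 * ?D\<^sup>2 * ?A\<^sup>2 + ?A\<^sup>2 * ?B ^ 4 + K\<^sup>2 * ?B\<^sup>2) / (?A ^ 3 * ?B ^ 4)"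
      using pos by (simp add: divide_simps) (simp add: eval_nat_numeral algebra_simps)
    also have "- (?A\<^sup>2 + ?B\<^sup>2) * ?A\<^sup>2 * ?B\<^sup>2 + ?D\<^sup>2 * ?B\<^sup>2 + 2 * ?D\<^sup>2 * ?A\<^sup>2 + ?A\<^sup>2 * ?B ^ 4 + K\<^sup>2 * ?B\<^sup>2
        = - (?A\<^sup>2 * (2 * K\<^sup>2 - 2 * ?B ^ 4 - ?B\<^sup>2))"
      unfolding D_sq A_sq_B by algebra
    also have "K * \<dots> / (?A ^ 3 * ?B ^ 4) = - (?B * W a 1 s) * (K / (?A * ?B))"
      unfolding W1 using pos by (simp add: divide_simps) (simp add: eval_nat_numeral algebra_simps)
    finally show ?thesis .
  qed
  have C: "?\<delta>' - ?f * (K * ?D / (?A * ?B\<^sup>2)) = - (?B * W a 1 s) * (?D / ?A)"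
  proof -
    have "?\<delta>' - ?f * (K * ?D / (?A * ?B\<^sup>2)) =
        ?D * (?A\<^sup>2 * ?B ^ 4 + ?A ^ 4 * ?B\<^sup>2 - K\<^sup>2 * (?A\<^sup>2 + ?B\<^sup>2) - K\<^sup>2) / (?A ^ 3 * ?B ^ 3)"
      using pos by (simp add: divide_simps) (simp add: eval_nat_numeral algebra_simps)
    also have "?A\<^sup>2 * ?B ^ 4 + ?A ^ 4 * ?B\<^sup>2 - K\<^sup>2 * (?A\<^sup>2 + ?B\<^sup>2) - K\<^sup>2
        = - (?A\<^sup>2 * (2 * K\<^sup>2 - 2 * ?B ^ 4 - ?B\<^sup>2))"
      using A_sq_B[of s] by algebra
    also have "?D * \<dots> / (?A ^ 3 * ?B ^ 3) = - (?B * W a 1 s) * (?D / ?A)"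
      unfolding W1 using pos by (simp add: divide_simps) (simp add: eval_nat_numeral algebra_simps)
    finally show ?thesis .
  qed
  show ?thesis
    by (rule DERIV_cong[OF deriv], unfold eq S C jacobi_profile_def) (simp only: algebra_simps)
qed

lemma jacobi_profile_pos:
  assumes "d > 0" "s \<ge> 0"
  shows "jacobi_profile d s > 0"
proof -
  have "sinh (\<phi> s) \<ge> 0" using phi_nonneg[OF assms(2)] by simp
  moreover have "d * cosh (\<phi> s) > 0" using assms(1) by (simp add: cosh_real_pos)
  ultimately have "tilt_sinh d s > 0" unfolding tilt_sinh_def by (rule add_nonneg_pos)
  moreover have "tilt_cosh d s > 0"
    using \<open>sinh (\<phi> s) \<ge> 0\<close> assms(1) cosh_real_pos[of "\<phi> s"] by (simp add: tilt_cosh_def add_pos_nonneg)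
  ultimately show ?thesis
    unfolding jacobi_profile_def using A_pos[of s] B_pos[of s] K_pos D_nonneg[OF assms(2)]
    by (intro add_pos_nonneg mult_pos_pos mult_nonneg_nonneg divide_nonneg_nonneg divide_pos_pos) auto
qed

text \<open>
  At \<open>s\<^sub>0\<close> the free boundary condition says that the conormal points along the position vector, up to
  the time direction. A rotation does not see the time direction, so its normal component grows at
  the rate \<open>coth r\<close>.
\<close>

lemma rotation_field_Robin: "jacobi_profile 0 s\<^sub>0 > 0" "jacobi_flux 0 s\<^sub>0 / jacobi_profile 0 s\<^sub>0 = coth (cat_r a) * B s\<^sub>0"
proof -
  let ?A = "A s\<^sub>0" and ?B = "B s\<^sub>0" and ?D = "D s\<^sub>0"
  have pos: "?A > 0" "?B > 0" by (rule A_pos B_pos)+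
  obtain m where m: "m > 0" "sinh (\<phi> s\<^sub>0) = m * (?B * K)" "cosh (\<phi> s\<^sub>0) = m * ?D"
    by (rule free_boundary_ratio)
  have SC: "tilt_sinh 0 s\<^sub>0 = m * (?B * K)" "tilt_cosh 0 s\<^sub>0 = m * ?D"
    by (simp_all add: tilt_sinh_def tilt_cosh_def m)
  have "jacobi_profile 0 s\<^sub>0 = m * (K\<^sup>2 + ?D\<^sup>2) / ?A"
    unfolding jacobi_profile_def SC using pos by (simp add: field_simps power2_eq_square)
  also have "\<dots> = m * ?A * ?B\<^sup>2"
    unfolding D_sq using pos by (simp add: field_simps power2_eq_square)
  finally have z: "jacobi_profile 0 s\<^sub>0 = m * ?A * ?B\<^sup>2" .
  have p: "jacobi_flux 0 s\<^sub>0 = m * ?A * ?B * ?D"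
    unfolding jacobi_flux_def SC using pos by (simp add: field_simps power2_eq_square)
  show "jacobi_profile 0 s\<^sub>0 > 0"
    using m(1) pos by (simp add: z)
  show "jacobi_flux 0 s\<^sub>0 / jacobi_profile 0 s\<^sub>0 = coth (cat_r a) * B s\<^sub>0"
    unfolding coth_r z p using m(1) pos by (simp add: field_simps power2_eq_square)
qed

section \<open>Coercivity of the radial form on odd functions\<close>

text \<open>
  Picone's inequality is applied with \<open>jacobi_profile d\<close> for \<open>d > 0\<close>, which is positive at 0 too, and
  then \<open>d\<close> tends to 0 from the right.
\<close>

lemma half_coercivity_mode_1:
  assumes u: "primitive_on 0 s\<^sub>0 u g" and g2: "set_integrable lborel {0..s\<^sub>0} (\<lambda>x. (g x)\<^sup>2)" and u0: "u 0 = 0"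
  shows "coth (cat_r a) * B s\<^sub>0 * (u s\<^sub>0)\<^sup>2 \<le> (LBINT s:{0..s\<^sub>0}. B s * (g s)\<^sup>2 - B s * W a 1 s * (u s)\<^sup>2)"
proof (rule tendsto_upperbound)
  show "((\<lambda>d. jacobi_flux d s\<^sub>0 / jacobi_profile d s\<^sub>0 * (u s\<^sub>0)\<^sup>2) \<longlongrightarrow> coth (cat_r a) * B s\<^sub>0 * (u s\<^sub>0)\<^sup>2) (at_right 0)"
    unfolding rotation_field_Robin(2)[symmetric]
  proof (intro tendsto_mult tendsto_divide tendsto_const)
    show "((\<lambda>d. jacobi_flux d s\<^sub>0) \<longlongrightarrow> jacobi_flux 0 s\<^sub>0) (at_right 0)"
      "((\<lambda>d. jacobi_profile d s\<^sub>0) \<longlongrightarrow> jacobi_profile 0 s\<^sub>0) (at_right 0)"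
      unfolding jacobi_flux_def jacobi_profile_def tilt_sinh_def tilt_cosh_def by (intro tendsto_intros)+
    show "jacobi_profile 0 s\<^sub>0 \<noteq> 0" using rotation_field_Robin(1) by simp
  qed
  show "\<forall>\<^sub>F d in at_right 0. jacobi_flux d s\<^sub>0 / jacobi_profile d s\<^sub>0 * (u s\<^sub>0)\<^sup>2
      \<le> (LBINT s:{0..s\<^sub>0}. B s * (g s)\<^sup>2 - B s * W a 1 s * (u s)\<^sup>2)"
  proof (rule eventually_at_right_less[THEN eventually_mono])
    fix d :: real assume "0 < d"
    show "jacobi_flux d s\<^sub>0 / jacobi_profile d s\<^sub>0 * (u s\<^sub>0)\<^sup>2
      \<le> (LBINT s:{0..s\<^sub>0}. B s * (g s)\<^sup>2 - B s * W a 1 s * (u s)\<^sup>2)"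
    proof (rule picone_inequality[OF u g2])
      show "continuous_on {0..s\<^sub>0} (\<lambda>s. B s * W a 1 s)"
        by (intro continuous_intros continuous_on_AB continuous_on_W)
      show "0 \<le> s\<^sub>0" using s0_properties(1) by simp
      show "(jacobi_profile d has_real_derivative jacobi_flux d s / B s) (at s)" for s
        by (rule has_deriv_jacobi_profile)
      show "(jacobi_flux d has_real_derivative - (B s * W a 1 s) * jacobi_profile d s) (at s)" for s
        by (rule has_deriv_jacobi_flux)
    qed (use \<open>0 < d\<close> in \<open>auto simp: u0 B_pos jacobi_profile_pos continuous_on_AB\<close>)
  qed
qed simp

text \<open>
  Since \<open>B W\<^sub>1 = B W\<^sub>k + (k\<^sup>2 - 1)/B\<close> and \<open>1/B \<ge> B/B(s\<^sub>0)\<^sup>2\<close>, the mode 1 inequality leaves a multiple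
  of the weighted norm.
\<close>

lemma half_coercivity:
  fixes k :: int
  assumes u: "primitive_on 0 s\<^sub>0 u g" and g2: "set_integrable lborel {0..s\<^sub>0} (\<lambda>x. (g x)\<^sup>2)" and u0: "u 0 = 0"
    and k: "\<bar>k\<bar> \<ge> 1"
  shows "((real_of_int k)\<^sup>2 - 1) / (B s\<^sub>0)\<^sup>2 * (LBINT s:{0..s\<^sub>0}. B s * (u s)\<^sup>2)
    \<le> (LBINT s:{0..s\<^sub>0}. B s * (g s)\<^sup>2 - B s * W a k s * (u s)\<^sup>2) - coth (cat_r a) * B s\<^sub>0 * (u s\<^sub>0)\<^sup>2"
proof -
  let ?I = "{0..s\<^sub>0}" and ?c = "((real_of_int k)\<^sup>2 - 1) / (B s\<^sub>0)\<^sup>2"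
  have cu: "continuous_on ?I u" by (rule primitive_on_continuous[OF u])
  have k1: "(real_of_int k)\<^sup>2 - 1 \<ge> 0"
    using k by (metis abs_le_square_iff abs_one diff_ge_0_iff_ge of_int_1_le_iff of_int_abs one_power2 power2_abs)
  have int: "set_integrable lborel ?I (\<lambda>s. B s * (g s)\<^sup>2 - B s * W a j s * (u s)\<^sup>2)" for j
    by (intro set_integral_diff(1) set_integrable_mult_continuous g2 continuous_on_AB
        borel_integrable_atLeastAtMost' continuous_intros continuous_on_W cu)
  have intB: "set_integrable lborel ?I (\<lambda>s. ?c * (B s * (u s)\<^sup>2))"
    by (intro borel_integrable_atLeastAtMost' continuous_intros continuous_on_AB cu) (use B_pos[of s\<^sub>0] in simp)
  have "coth (cat_r a) * B s\<^sub>0 * (u s\<^sub>0)\<^sup>2 + ?c * (LBINT s:?I. B s * (u s)\<^sup>2)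
      \<le> (LBINT s:?I. B s * (g s)\<^sup>2 - B s * W a 1 s * (u s)\<^sup>2) + (LBINT s:?I. ?c * (B s * (u s)\<^sup>2))"
    using half_coercivity_mode_1[OF u g2 u0] by simp
  also have "\<dots> = (LBINT s:?I. (B s * (g s)\<^sup>2 - B s * W a 1 s * (u s)\<^sup>2) + ?c * (B s * (u s)\<^sup>2))"
    by (rule set_integral_add(2)[OF int intB, symmetric])
  also have "\<dots> \<le> (LBINT s:?I. B s * (g s)\<^sup>2 - B s * W a k s * (u s)\<^sup>2)"
  proof (rule set_integral_mono[OF set_integral_add(1)[OF int intB] int])
    fix s assume s: "s \<in> ?I"
    have "B s \<le> B s\<^sub>0" using s by (intro B_mono) auto
    then have "(B s)\<^sup>2 \<le> (B s\<^sub>0)\<^sup>2" using B_pos[of s] by (intro power_mono) auto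
    then have "?c \<le> ((real_of_int k)\<^sup>2 - 1) / (B s)\<^sup>2"
      using k1 B_pos[of s] B_pos[of s\<^sub>0] by (intro divide_left_mono mult_pos_pos) auto
    then have "?c * (B s * (u s)\<^sup>2) \<le> ((real_of_int k)\<^sup>2 - 1) / (B s)\<^sup>2 * (B s * (u s)\<^sup>2)"
      using B_pos[of s] by (intro mult_right_mono) auto
    also have "\<dots> = ((real_of_int k)\<^sup>2 - 1) / B s * (u s)\<^sup>2"
      using B_pos[of s] by (simp add: power2_eq_square)
    finally show "(B s * (g s)\<^sup>2 - B s * W a 1 s * (u s)\<^sup>2) + ?c * (B s * (u s)\<^sup>2)
        \<le> B s * (g s)\<^sup>2 - B s * W a k s * (u s)\<^sup>2"
      unfolding W_mode[of s k] by (simp add: algebra_simps)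
  qed
  finally show ?thesis by simp
qed

text \<open>
  The inequality on \<open>[0, s\<^sub>0]\<close> is used twice. A weak derivative of an odd function is even almost
  everywhere only, so the left half contributes with the reflected derivative \<open>g (- x)\<close>, which is
  another density for the same \<open>u\<close>.
\<close>

lemma odd_coercivity:
  assumes u: "u \<in> H1_odd s\<^sub>0" and k: "\<bar>k\<bar> \<ge> 1"
  shows "((real_of_int k)\<^sup>2 - 1) / (B s\<^sub>0)\<^sup>2 * B_inner a u u \<le> S_rad a k u u"
proof -
  let ?I = "{0..s\<^sub>0}" and ?c = "((real_of_int k)\<^sup>2 - 1) / (B s\<^sub>0)\<^sup>2"
  have s0: "0 < s\<^sub>0" by (rule s0_properties)
  have odd: "u (- x) = - u x" for x using u by (simp add: H1_odd_def)
  have cu: "continuous_on {-s\<^sub>0..s\<^sub>0} u" and "\<exists>g. has_weak_deriv s\<^sub>0 u g"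
    using u by (simp_all add: H1_odd_def H1_def)
  define g where "g = weak_deriv s\<^sub>0 u"
  have weak: "has_weak_deriv s\<^sub>0 u g"
    unfolding g_def weak_deriv_def using \<open>\<exists>g. has_weak_deriv s\<^sub>0 u g\<close> by (rule someI_ex)
  then have "L2_on {-s\<^sub>0<..<s\<^sub>0} g" by (simp add: has_weak_deriv_def)
  then have g2: "set_integrable lborel {-s\<^sub>0..s\<^sub>0} (\<lambda>x. (g x)\<^sup>2)"
    by (rule L2_on_imp_set_integrable(2))
  have prim: "primitive_on (-s\<^sub>0) s\<^sub>0 u g"
    by (rule weak_deriv_primitive_on[OF s0 cu weak])
  have "primitive_on (- s\<^sub>0) (- (- s\<^sub>0)) (\<lambda>x. - u (- x)) (\<lambda>x. g (- x))"
    by (rule primitive_on_reflect[OF prim])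
  then have prim': "primitive_on (- s\<^sub>0) s\<^sub>0 u (\<lambda>x. g (- x))"
    by (simp add: odd)
  have g2': "set_integrable lborel {-s\<^sub>0..s\<^sub>0} (\<lambda>x. (g (- x))\<^sup>2)"
    using set_integrable_reflect[OF g2] by simp
  have half: "primitive_on 0 s\<^sub>0 u g" "primitive_on 0 s\<^sub>0 u (\<lambda>x. g (- x))"
    using s0 by (auto intro: primitive_on_restrict_left[OF prim] primitive_on_restrict_left[OF prim'])
  have half2: "set_integrable lborel ?I (\<lambda>x. (g x)\<^sup>2)" "set_integrable lborel ?I (\<lambda>x. (g (- x))\<^sup>2)"
    using s0 by (auto intro: set_integrable_subset[OF g2] set_integrable_subset[OF g2'])
  have u0: "u 0 = 0" using odd[of 0] by simp
  let ?F = "\<lambda>s. B s * (g s)\<^sup>2 - B s * W a k s * (u s)\<^sup>2"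
  have "set_integrable lborel {-s\<^sub>0..s\<^sub>0} ?F"
    by (intro set_integral_diff(1) set_integrable_mult_continuous g2 continuous_on_AB
        borel_integrable_atLeastAtMost' continuous_intros continuous_on_W cu)
  then have "(LBINT s:{-s\<^sub>0<..<s\<^sub>0}. ?F s) = (LBINT s:?I. ?F s) + (LBINT s:?I. ?F (- s))"
    using s0 by (intro LBINT_symmetric_interval) auto
  then have F: "(LBINT s:{-s\<^sub>0<..<s\<^sub>0}. ?F s) =
      (LBINT s:?I. ?F s) + (LBINT s:?I. B s * (g (- s))\<^sup>2 - B s * W a k s * (u s)\<^sup>2)"
    by (simp add: odd B_even W_even)
  have S: "S_rad a k u u = (LBINT s:{-s\<^sub>0<..<s\<^sub>0}. ?F s) - coth (cat_r a) * B s\<^sub>0 * (2 * (u s\<^sub>0)\<^sup>2)"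
    by (simp add: S_rad_def Let_def odd g_def[symmetric] power2_eq_square mult.assoc)
  have "set_integrable lborel {-s\<^sub>0..s\<^sub>0} (\<lambda>s. B s * (u s)\<^sup>2)"
    by (intro borel_integrable_atLeastAtMost' continuous_intros continuous_on_AB cu)
  then have "(LBINT s:{-s\<^sub>0<..<s\<^sub>0}. B s * (u s)\<^sup>2) = (LBINT s:?I. B s * (u s)\<^sup>2) + (LBINT s:?I. B (- s) * (u (- s))\<^sup>2)"
    using s0 by (intro LBINT_symmetric_interval) auto
  then have I: "B_inner a u u = 2 * (LBINT s:?I. B s * (u s)\<^sup>2)"
    by (simp add: B_inner_def power2_eq_square mult.assoc odd B_even)
  have "?c * (LBINT s:?I. B s * (u s)\<^sup>2) \<le> (LBINT s:?I. ?F s) - coth (cat_r a) * B s\<^sub>0 * (u s\<^sub>0)\<^sup>2"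
    by (rule half_coercivity[OF half(1) half2(1) u0 k])
  moreover have "?c * (LBINT s:?I. B s * (u s)\<^sup>2)
      \<le> (LBINT s:?I. B s * (g (- s))\<^sup>2 - B s * W a k s * (u s)\<^sup>2) - coth (cat_r a) * B s\<^sub>0 * (u s\<^sub>0)\<^sup>2"
    by (rule half_coercivity[OF half(2) half2(2) u0 k])
  moreover have "c * (2 * x) \<le> y + z - t * (2 * v)" if "c * x \<le> y - t * v" "c * x \<le> z - t * v"
    for c x y z t v :: real
    using that by simp
  ultimately show ?thesis
    unfolding S F I by blast
qed

lemma weighted_integral_eq_0D:
  assumes u: "continuous_on {l..r} u" and lr: "l < r" and "(LBINT s:{l..r}. B s * (u s)\<^sup>2) \<le> 0"
    and x: "x \<in> {l..r}"
  shows "u x = 0"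
proof -
  have c: "continuous_on {l..r} (\<lambda>s. B s * (u s)\<^sup>2)"
    by (intro continuous_intros continuous_on_AB u)
  have nonneg: "B s * (u s)\<^sup>2 \<ge> 0" for s using B_pos[of s] by simp
  have "integral {l..r} (\<lambda>s. B s * (u s)\<^sup>2) \<le> 0"
    using assms(3) set_borel_integral_eq_integral(2)[OF borel_integrable_atLeastAtMost'[OF c]] by simp
  moreover have "integral {l..r} (\<lambda>s. B s * (u s)\<^sup>2) \<ge> 0"
    by (rule integral_nonneg[OF integrable_continuous_interval[OF c]]) (use nonneg in auto)
  ultimately have "B x * (u x)\<^sup>2 = 0"
    using integral_eq_0_iff[OF c lr] nonneg x by auto
  then show ?thesis using B_pos[of x] by simp
qed

lemma B_inner_pos:
  assumes u: "u \<in> H1_odd s\<^sub>0" and "u \<noteq> 0"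
  shows "B_inner a u u > 0"
proof (rule ccontr)
  assume "\<not> B_inner a u u > 0"
  then have "(LBINT s:{-s\<^sub>0..s\<^sub>0}. B s * (u s)\<^sup>2) \<le> 0"
    by (simp add: B_inner_def set_integral_open_eq_closed power2_eq_square mult.assoc)
  moreover have "continuous_on {-s\<^sub>0..s\<^sub>0} u" and out: "\<And>x. x \<notin> {-s\<^sub>0..s\<^sub>0} \<Longrightarrow> u x = 0"
    using u by (simp_all add: H1_odd_def H1_def)
  ultimately have "u x = 0" for x
    using weighted_integral_eq_0D[of "-s\<^sub>0" s\<^sub>0 u x] s0_properties(1) by (cases "x \<in> {-s\<^sub>0..s\<^sub>0}") auto
  then show False using \<open>u \<noteq> 0\<close> by (auto simp: fun_eq_iff)
qed

lemma spectral_gap_pos: "\<bar>k\<bar> \<ge> 2 \<Longrightarrow> ((real_of_int k)\<^sup>2 - 1) / (B s\<^sub>0)\<^sup>2 > 0"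
proof -
  assume "\<bar>k\<bar> \<ge> 2"
  then have "2 \<le> \<bar>real_of_int k\<bar>" by linarith
  then have "2\<^sup>2 \<le> (real_of_int k)\<^sup>2" using abs_le_square_iff[of 2 "real_of_int k"] by simp
  then show ?thesis using B_pos[of s\<^sub>0] by simp
qed

end

section \<open>The odd spectrum\<close>

lemma vector_space_fscale: "vector_space fscale"
  by unfold_locales (auto simp: fscale_def fun_eq_iff algebra_simps)

context catenoid
begin

text \<open>
  A space of positive dimension contains a nonzero function, and one Rayleigh quotient already bounds
  the supremum from below.
\<close>

lemma mu_odd_ge:
  assumes k: "\<bar>k\<bar> \<ge> 1"
  shows "mu_odd a k n \<ge> ereal (((real_of_int k)\<^sup>2 - 1) / (B s\<^sub>0)\<^sup>2)"
  unfolding mu_odd_def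
proof (rule INF_greatest)
  fix V assume V: "V \<in> {V. module.subspace fscale V \<and> V \<subseteq> H1_odd s\<^sub>0 \<and> vector_space.dim fscale V = Suc n}"
  interpret vector_space fscale by (rule vector_space_fscale)
  have "\<not> V \<subseteq> {0}"
  proof
    assume "V \<subseteq> {0}"
    then have "dim V \<le> card ({} :: (real \<Rightarrow> real) set)"
      by (intro dim_le_card) auto
    then show False using V by simp
  qed
  then obtain u where u: "u \<in> V - {0}" by auto
  then have "u \<in> H1_odd s\<^sub>0" "u \<noteq> 0" using V by auto
  then have "((real_of_int k)\<^sup>2 - 1) / (B s\<^sub>0)\<^sup>2 \<le> S_rad a k u u / B_inner a u u"
    using odd_coercivity[OF _ k] by (subst pos_le_divide_eq) (auto intro: B_inner_pos)
  then show "ereal (((real_of_int k)\<^sup>2 - 1) / (B s\<^sub>0)\<^sup>2)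
      \<le> (SUP u \<in> V - {0}. ereal (S_rad a k u u / B_inner a u u))"
    by (intro SUP_upper2[OF u]) simp
qed

lemma odd_eigenvalue_ge:
  assumes k: "\<bar>k\<bar> \<ge> 1" and "odd_eigenvalue a k l"
  shows "l \<ge> ((real_of_int k)\<^sup>2 - 1) / (B s\<^sub>0)\<^sup>2"
proof -
  obtain u where u: "u \<in> H1_odd s\<^sub>0" "u \<noteq> 0" "S_rad a k u u = l * B_inner a u u"
    using assms(2) by (auto simp: odd_eigenvalue_def)
  show ?thesis
    using odd_coercivity[OF u(1) k] B_inner_pos[OF u(1,2)] unfolding u(3)
    by (rule mult_right_le_imp_le)
qed

section \<open>Robin Jacobi fields\<close>

text \<open>
  The odd part \<open>w s = v s - v (- s)\<close> solves the same equation. Integrating \<open>(w B w')'\<close> shows that its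
  form, boundary term included, is 0, so coercivity forces \<open>w = 0\<close>.
\<close>

lemma Robin_solution_even:
  assumes k: "\<bar>k\<bar> \<ge> 2"
    and v: "primitive_on (-s\<^sub>0) s\<^sub>0 v v'" and v': "continuous_on {-s\<^sub>0..s\<^sub>0} v'"
    and ode: "primitive_on (-s\<^sub>0) s\<^sub>0 (\<lambda>s. B s * v' s) (\<lambda>s. - (B s * W a k s * v s))"
    and robin: "v' s\<^sub>0 = coth (cat_r a) * v s\<^sub>0" "- v' (- s\<^sub>0) = coth (cat_r a) * v (- s\<^sub>0)"
    and s: "s \<in> {-s\<^sub>0..s\<^sub>0}"
  shows "v (- s) = v s"
proof -
  have s0: "0 < s\<^sub>0" by (rule s0_properties)
  define w where "w s = v s - v (- s)" for s
  define w' where "w' s = v' s + v' (- s)" for s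
  have w: "primitive_on 0 s\<^sub>0 w w'"
  proof -
    have "primitive_on (-s\<^sub>0) s\<^sub>0 w w'"
      using primitive_on_linear[OF v primitive_on_reflect[OF v, simplified], of 1 1]
      by (simp add: w_def[abs_def] w'_def[abs_def])
    then show ?thesis by (rule primitive_on_restrict_left) (use s0 in auto)
  qed
  have Bw': "primitive_on 0 s\<^sub>0 (\<lambda>s. B s * w' s) (\<lambda>s. - (B s * W a k s * w s))"
  proof -
    have "primitive_on (-s\<^sub>0) s\<^sub>0 (\<lambda>s. B s * w' s) (\<lambda>s. - (B s * W a k s * w s))"
      using primitive_on_linear[OF ode primitive_on_reflect[OF ode, simplified], of 1 "-1"]
      by (simp add: w_def w'_def B_even W_even algebra_simps)
    then show ?thesis by (rule primitive_on_restrict_left) (use s0 in auto)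
  qed
  have cw': "continuous_on {0..s\<^sub>0} w'"
    unfolding w'_def by (intro continuous_intros continuous_on_subset[OF v'] continuous_on_compose2[OF v']) (use s0 in auto)
  have cw: "continuous_on {0..s\<^sub>0} w" by (rule primitive_on_continuous[OF w])
  have w0: "w 0 = 0" by (simp add: w_def)
  have "w' s\<^sub>0 = coth (cat_r a) * w s\<^sub>0"
    using robin by (simp add: w_def w'_def algebra_simps)
  moreover have "(LBINT s:{0..s\<^sub>0}. w s * - (B s * W a k s * w s) + B s * w' s * w' s)
      = w s\<^sub>0 * (B s\<^sub>0 * w' s\<^sub>0) - w 0 * (B 0 * w' 0)"
    by (rule primitive_on_integral[OF primitive_on_mult[OF w Bw']]) (use s0 in simp)
  ultimately have "(LBINT s:{0..s\<^sub>0}. B s * (w' s)\<^sup>2 - B s * W a k s * (w s)\<^sup>2)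
      = coth (cat_r a) * B s\<^sub>0 * (w s\<^sub>0)\<^sup>2"
    by (simp add: w0 power2_eq_square algebra_simps)
  moreover have "((real_of_int k)\<^sup>2 - 1) / (B s\<^sub>0)\<^sup>2 * (LBINT s:{0..s\<^sub>0}. B s * (w s)\<^sup>2)
    \<le> (LBINT s:{0..s\<^sub>0}. B s * (w' s)\<^sup>2 - B s * W a k s * (w s)\<^sup>2) - coth (cat_r a) * B s\<^sub>0 * (w s\<^sub>0)\<^sup>2"
  proof (rule half_coercivity[OF w _ w0])
    show "set_integrable lborel {0..s\<^sub>0} (\<lambda>x. (w' x)\<^sup>2)"
      by (intro borel_integrable_atLeastAtMost' continuous_intros cw')
  qed (use k in simp)
  ultimately have "((real_of_int k)\<^sup>2 - 1) / (B s\<^sub>0)\<^sup>2 * (LBINT s:{0..s\<^sub>0}. B s * (w s)\<^sup>2)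
      \<le> ((real_of_int k)\<^sup>2 - 1) / (B s\<^sub>0)\<^sup>2 * 0"
    by simp
  then have "(LBINT s:{0..s\<^sub>0}. B s * (w s)\<^sup>2) \<le> 0"
    using spectral_gap_pos[OF k] by (rule mult_left_le_imp_le)
  then have w_0: "w x = 0" if "x \<in> {0..s\<^sub>0}" for x
    by (rule weighted_integral_eq_0D[OF cw s0 _ that])
  show ?thesis
    using w_0[of s] w_0[of "- s"] s by (cases "s \<ge> 0") (auto simp: w_def)
qed

text \<open>
  Along a fixed angle \<open>\<theta>\<close>, the second angular derivative of a field of mode \<open>k\<close> is \<open>- k\<^sup>2\<close> times the
  field, so the Jacobi equation turns into the radial equation with potential \<open>W\<^sub>k\<close>.
\<close>

lemma Jacobi_field_even_in_s:
  assumes k: "\<bar>k\<bar> \<ge> 2" and jac: "robin_jacobi_field a u" and prof: "radial_profiles a k u \<alpha> \<beta>"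
    and s: "s \<in> {-s\<^sub>0..s\<^sub>0}"
  shows "u (- s) \<theta> = u s \<theta>"
proof -
  let ?I = "{-s\<^sub>0..s\<^sub>0}" and ?v = "\<lambda>s. u s \<theta>" and ?v' = "\<lambda>s. pd_s s\<^sub>0 u s \<theta>"
  let ?v'' = "\<lambda>s. pd_s s\<^sub>0 (pd_s s\<^sub>0 u) s \<theta>"
  have s0: "0 < s\<^sub>0" by (rule s0_properties)
  have "Ck_annulus 2 s\<^sub>0 u"
    using jac by (simp add: robin_jacobi_field_def Let_def)
  then have C: "Ck_annulus (Suc (Suc 0)) s\<^sub>0 u" by (simp only: numeral_2_eq_2)
  have d1: "?v differentiable (at t within ?I)" and d2: "?v' differentiable (at t within ?I)"
    if "t \<in> ?I" for t
    using C that by auto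
  have c1: "continuous_on (?I \<times> UNIV) (\<lambda>(s, \<theta>). pd_s s\<^sub>0 u s \<theta>)"
    and c0: "continuous_on (?I \<times> UNIV) (\<lambda>(s, \<theta>). u s \<theta>)"
    using C by simp_all
  have cv: "continuous_on ?I ?v" "continuous_on ?I ?v'"
    using continuous_on_compose2[OF c0, of ?I "\<lambda>s. (s, \<theta>)"] continuous_on_compose2[OF c1, of ?I "\<lambda>s. (s, \<theta>)"]
    by (simp_all add: continuous_on_Pair image_subset_iff)
  have v: "(?v has_vector_derivative ?v' t) (at t within ?I)" if "t \<in> ?I" for t
    using d1[OF that] unfolding pd_s_def vector_derivative_works .
  have flux_equation: "q = - (b * (i - 2 - m / b\<^sup>2) * x)" if "b > 0" "(q - m * x / b) / b + (i - 2) * x = 0"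
    for b q m x i :: real
  proof -
    have "q - m * x / b = - ((i - 2) * x) * b"
      using that by (metis add.inverse_unique add.commute nonzero_divide_eq_eq order_less_irrefl)
    moreover have "b * (m / b\<^sup>2) = m / b"
      using that(1) by (simp add: power2_eq_square)
    ultimately show ?thesis by (simp add: algebra_simps)
  qed
  have Bv': "((\<lambda>s. B s * ?v' s) has_vector_derivative - (B t * W a k t * u t \<theta>)) (at t within ?I)"
    if t: "t \<in> ?I" for t
  proof -
    have "B differentiable (at t within ?I)"
      using has_deriv_B[of t] by (meson has_field_derivative_at_within real_differentiable_def)
    then have "(\<lambda>s. B s * ?v' s) differentiable (at t within ?I)"
      using d2[OF t] by (rule differentiable_mult)
    then have works: "((\<lambda>s. B s * ?v' s) has_vector_derivative
        vector_derivative (\<lambda>s. B s * ?v' s) (at t within ?I)) (at t within ?I)"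
      by (rule vector_derivative_works[THEN iffD1])
    have trig: "u t = (\<lambda>\<theta>. \<alpha> t * cos (real_of_int k * \<theta>) + \<beta> t * sin (real_of_int k * \<theta>))"
      using prof t by (auto simp: radial_profiles_def)
    have th1: "pd_th u t = (\<lambda>\<theta>. real_of_int k * (\<beta> t * cos (real_of_int k * \<theta>) - \<alpha> t * sin (real_of_int k * \<theta>)))"
      unfolding pd_th_def trig
      by (rule ext, rule DERIV_imp_deriv) (auto intro!: derivative_eq_intros simp: algebra_simps)
    have th2: "deriv (\<lambda>\<theta>. pd_th u t \<theta> / B t) \<theta> = - (real_of_int k)\<^sup>2 * u t \<theta> / B t"
      unfolding th1 unfolding trig
      by (rule DERIV_imp_deriv)
        (auto intro!: derivative_eq_intros simp: B_pos[THEN less_imp_neq[THEN not_sym]] field_simps power2_eq_square)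
    \<comment> \<open>The area density of the metric is \<open>B\<close>, in the form \<open>sqrt (1 * B\<^sup>2 - 0\<^sup>2)\<close>.\<close>
    have G: "(\<lambda>t. (B t)\<^sup>2 * ?v' t / sqrt ((B t)\<^sup>2)) = (\<lambda>t. B t * ?v' t)"
      using B_pos by (auto simp: fun_eq_iff power2_eq_square less_imp_le real_sqrt_mult)
    have "jacobi_op a u t \<theta> = 0"
      using jac t by (simp add: robin_jacobi_field_def Let_def)
    then have "(vector_derivative (\<lambda>s. B s * ?v' s) (at t within ?I) - (real_of_int k)\<^sup>2 * u t \<theta> / B t) / B t
        + (II_sq a t - 2) * u t \<theta> = 0"
      using th2 G B_pos[of t]
      by (simp add: jacobi_op_def laplace_beltrami_def Let_def pd_s_def[of _ "\<lambda>s \<theta>. _ s \<theta> / _ s \<theta>"] pd_th_def[of "\<lambda>s \<theta>. _ s \<theta> / _ s \<theta>"])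
    then have "vector_derivative (\<lambda>s. B s * ?v' s) (at t within ?I) = - (B t * W a k t * u t \<theta>)"
      unfolding W_def by (rule flux_equation[OF B_pos])
    with works show ?thesis by simp
  qed
  show ?thesis
  proof (rule Robin_solution_even[OF k _ cv(2) _ _ _ s])
    show "primitive_on (-s\<^sub>0) s\<^sub>0 ?v ?v'"
      by (rule primitive_on_C1[OF v cv(2)])
    show "primitive_on (-s\<^sub>0) s\<^sub>0 (\<lambda>s. B s * ?v' s) (\<lambda>s. - (B s * W a k s * ?v s))"
      by (rule primitive_on_C1[OF Bv']) (auto intro!: continuous_intros continuous_on_AB continuous_on_W cv)
    show "?v' s\<^sub>0 = coth (cat_r a) * ?v s\<^sub>0" "- ?v' (- s\<^sub>0) = coth (cat_r a) * ?v (- s\<^sub>0)"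
      using jac by (simp_all add: robin_jacobi_field_def Let_def)
  qed
qed

text \<open>
  The profiles are the restrictions of the field to the angles \<open>0\<close> and \<open>\<pi>/(2k)\<close>.
\<close>

lemma Jacobi_field_radially_even:
  assumes k: "\<bar>k\<bar> \<ge> 2" and jac: "robin_jacobi_field a u"
  shows "radially_even a k u"
  unfolding radially_even_def
proof (intro allI impI ballI)
  fix \<alpha> \<beta> s
  assume prof: "radial_profiles a k u \<alpha> \<beta>" and s: "s \<in> {-s\<^sub>0..s\<^sub>0}"
  have val: "u t \<theta> = \<alpha> t * cos (real_of_int k * \<theta>) + \<beta> t * sin (real_of_int k * \<theta>)"
    if "t \<in> {-s\<^sub>0..s\<^sub>0}" for t \<theta>
    using prof that by (simp add: radial_profiles_def)
  have "u t 0 = \<alpha> t" "u t (pi / 2 / real_of_int k) = \<beta> t" if "t \<in> {-s\<^sub>0..s\<^sub>0}" for t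
    using val[OF that, of 0] val[OF that, of "pi / 2 / real_of_int k"] k by auto
  moreover have "- s \<in> {-s\<^sub>0..s\<^sub>0}" using s by simp
  ultimately show "\<alpha> (- s) = \<alpha> s \<and> \<beta> (- s) = \<beta> s"
    using Jacobi_field_even_in_s[OF k jac prof s] s by metis
qed

end

theorem theorem2:
  fixes a :: real and k :: int
  assumes "a > 1 / 2" and "\<bar>k\<bar> \<ge> 2"
  shows "(\<forall>n. mu_odd a k n > 0) \<and>
    ((\<forall>n. mu_odd a k n > 0) \<longleftrightarrow> (\<nexists>l. odd_eigenvalue a k l \<and> l \<le> 0)) \<and>
    (\<forall>u. robin_jacobi_field a u \<and> of_mode a k u \<longrightarrow> radially_even a k u)"
proof -
  interpret catenoid a by unfold_locales (rule assms(1))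
  let ?c = "((real_of_int k)\<^sup>2 - 1) / (cat_B a (cat_s0 a))\<^sup>2"
  have c: "?c > 0" by (rule spectral_gap_pos[OF assms(2)])
  have k: "\<bar>k\<bar> \<ge> 1" using assms(2) by simp
  have "mu_odd a k n > 0" for n
  proof -
    have "0 < ereal ?c" using c by simp
    also have "\<dots> \<le> mu_odd a k n" by (rule mu_odd_ge[OF k])
    finally show ?thesis .
  qed
  moreover have "\<not> (odd_eigenvalue a k l \<and> l \<le> 0)" for l
    using odd_eigenvalue_ge[OF k, of l] c by linarith
  ultimately show ?thesis
    using Jacobi_field_radially_even[OF assms(2)] by blast
qed

end
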